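(* Let $l$ be a straight line in $\mathbb{R}^2$ not passing through the origin, with a chosen Euclidean coordinate on it. Let $FCF_{1,l}\subset FCF_1$ be the chart of ordered pairs of distinct lines through the origin both of which intersect $l$, with coordinates $(x_l,y_l)$, $x_l\neq y_l$. Consider on $FCF_{1,l}$ the form $$\omega_l(x_l,y_l)=\frac{dx_l\wedge dy_l}{|x_l-y_l|^2}.$$ Then the measure $\mu_{\omega_l}$ on $FCF_{1,l}$ coincides with the restriction to $FCF_{1,l}$ of some Möbius measure of $FCF_1$.
   Context: $FCF_1$ (the manifold of framed one-dimensional continued fractions) is the set of ordered pairs of distinct straight lines through the origin in $\mathbb{R}^2$, i.e. $FCF_1=(\mathbb{R}P^1\times\mathbb{R}P^1)\setminus\Delta_1$ with $\Delta_1$ the diagonal; its smooth structure is that of an open subset of $\mathbb{R}P^1\times\mathbb{R}P^1$. The group $PGL(2,\mathbb{R})$ acts on $FCF_1$ by acting on each line of the pair. Chart: for a line $l$ not through the origin, $FCF_{1,l}$ is the set of pairs in $FCF_1$ such that both lines intersect $l$. A pair is assigned the coordinates $(x_l,y_l)$, where $x_l$ and $y_l$ are the Euclidean coordinates on $l$ of the intersection points of $l$ with the first and the second line respectively. So $FCF_{1,l}$ is identified with $\mathbb{R}\times\mathbb{R}$ minus its diagonal. For a volume form (form of the highest degree) $\omega$ on a manifold $M$, $\mu_\omega$ is the measure on $M$ determined by $\mu_\omega(S)=\left|\int_S\omega\right|$ for open measurable sets $S$ contained in one connected component of $M$. A Möbius form of $FCF_1$ is a form of the highest degree on $FCF_1$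 invariant under the action of $PGL(2,\mathbb{R})$. A Möbius measure of $FCF_1$ is a measure of the form $\mu_\omega$ with $\omega$ a Möbius form of $FCF_1$. *)

theory Defs
  imports "HOL-Analysis.Analysis" "HOL-Algebra.Coset"
begin

section \<open>Surfaces given by an atlas\<close>

text \<open>A chart is a pair of its domain and its coordinate map; the values of the map outside the
  domain are irrelevant. A surface is given by an atlas, its points are the points of the chart
  domains.\<close>

type_synonym ('m, 'e) chart = "'m set \<times> ('m \<Rightarrow> 'e)"
type_synonym 'm atlas = "('m, real \<times> real) chart set"

abbreviation chart_dom :: "('m, 'e) chart \<Rightarrow> 'm set" where
  "chart_dom c \<equiv> fst c"

abbreviation chart_map :: "('m, 'e) chart \<Rightarrow> 'm \<Rightarrow> 'e" where
  "chart_map c \<equiv> snd c"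

definition chart_inv :: "('m, 'e) chart \<Rightarrow> 'e \<Rightarrow> 'm" where
  "chart_inv c = inv_into (chart_dom c) (chart_map c)"

definition surface_points :: "'m atlas \<Rightarrow> 'm set" where
  "surface_points A = (\<Union>c\<in>A. chart_dom c)"

definition surface_topology :: "'m atlas \<Rightarrow> 'm topology" where
  "surface_topology A = topology (\<lambda>S. S \<subseteq> surface_points A \<and>
     (\<forall>c\<in>A. open (chart_map c ` (S \<inter> chart_dom c))))"

lemma openin_surface_topology:
  assumes inj: "\<And>c. c \<in> A \<Longrightarrow> inj_on (chart_map c) (chart_dom c)"
  shows "openin (surface_topology A) S \<longleftrightarrow> S \<subseteq> surface_points A \<and>
     (\<forall>c\<in>A. open (chart_map c ` (S \<inter> chart_dom c)))"
proof -
  have int: "chart_map c ` (S \<inter> T \<inter> chart_dom c) =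
      chart_map c ` (S \<inter> chart_dom c) \<inter> chart_map c ` (T \<inter> chart_dom c)"
    if "c \<in> A" for c S T
    using inj[OF that] unfolding inj_on_def by blast
  have un: "chart_map c ` (\<Union>K \<inter> chart_dom c) = (\<Union>S\<in>K. chart_map c ` (S \<inter> chart_dom c))" for c K
    by blast
  have "istopology (\<lambda>S. S \<subseteq> surface_points A \<and>
     (\<forall>c\<in>A. open (chart_map c ` (S \<inter> chart_dom c))))"
    unfolding istopology_def
  proof (intro conjI allI impI ballI)
    fix S T c assume "S \<subseteq> surface_points A \<and> (\<forall>c\<in>A. open (chart_map c ` (S \<inter> chart_dom c)))"
      "T \<subseteq> surface_points A \<and> (\<forall>c\<in>A. open (chart_map c ` (T \<inter> chart_dom c)))" "c \<in> A"
    then show "open (chart_map c ` (S \<inter> T \<inter> chart_dom c))"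
      by (simp add: int open_Int)
  next
    fix K c assume "\<forall>S\<in>K. S \<subseteq> surface_points A \<and>
      (\<forall>c\<in>A. open (chart_map c ` (S \<inter> chart_dom c)))" "c \<in> A"
    then show "open (chart_map c ` (\<Union>K \<inter> chart_dom c))"
      unfolding un by blast
  qed blast+
  then show ?thesis
    unfolding surface_topology_def by (simp add: topology_inverse')
qed

text \<open>The differential of \<open>g\<close> at \<open>p\<close>, in the coordinates of a chart \<open>c\<close> around \<open>p\<close> and of a
  chart \<open>d\<close> around \<open>g p\<close>.\<close>

definition local_differential ::
  "('m, real \<times> real) chart \<Rightarrow> ('m, real \<times> real) chart \<Rightarrow> ('m \<Rightarrow> 'm) \<Rightarrow> 'm \<Rightarrow> real \<times> real \<Rightarrow> real \<times> real"
  where "local_differential c d g p =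
    frechet_derivative (chart_map d \<circ> g \<circ> chart_inv c) (at (chart_map c p))"

section \<open>Forms of the highest degree\<close>

primrec C_k_on :: "nat \<Rightarrow> ('a::real_normed_vector \<Rightarrow> 'b::real_normed_vector) \<Rightarrow> 'a set \<Rightarrow> bool" where
  "C_k_on 0 f S \<longleftrightarrow> continuous_on S f"
| "C_k_on (Suc k) f S \<longleftrightarrow> (\<forall>x\<in>S. f differentiable (at x)) \<and>
     (\<forall>v. C_k_on k (\<lambda>x. frechet_derivative f (at x) v) S)"

text \<open>A 2-form \<open>w\<close> is represented by its local expressions: \<open>w c p u v\<close> is the value of the form
  at the point \<open>p\<close> on the two tangent vectors at \<open>p\<close> whose components in the chart \<open>c\<close> are \<open>u\<close>
  and \<open>v\<close>.\<close>

type_synonym 'm local_forms =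
  "('m, real \<times> real) chart \<Rightarrow> 'm \<Rightarrow> real \<times> real \<Rightarrow> real \<times> real \<Rightarrow> real"

text \<open>The equality of \<open>w\<close> and its pullback along \<open>g\<close>. For \<open>g = id\<close> this is the transformation law
  relating the local expressions of one form in different charts.\<close>

definition form_invariant :: "'m atlas \<Rightarrow> ('m \<Rightarrow> 'm) \<Rightarrow> 'm local_forms \<Rightarrow> bool" where
  "form_invariant A g w \<longleftrightarrow>
    (\<forall>c\<in>A. \<forall>d\<in>A. \<forall>p\<in>chart_dom c. g p \<in> chart_dom d \<longrightarrow>
      (\<forall>u v. w d (g p) (local_differential c d g p u) (local_differential c d g p v) = w c p u v))"

definition top_form :: "'m atlas \<Rightarrow> 'm local_forms \<Rightarrow> bool" where
  "top_form A w \<longleftrightarrow>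
    (\<forall>c\<in>A. \<forall>p\<in>chart_dom c. bilinear (w c p) \<and> (\<forall>u. w c p u u = 0)) \<and>
    (\<forall>c\<in>A. \<forall>u v k. C_k_on k (\<lambda>x. w c (chart_inv c x) u v) (chart_map c ` chart_dom c)) \<and>
    form_invariant A id w"

definition dx_wedge_dy :: "real \<times> real \<Rightarrow> real \<times> real \<Rightarrow> real" where
  "dx_wedge_dy u v = fst u * snd v - snd u * fst v"

section \<open>The measure of a form\<close>

text \<open>An orientation of an open set \<open>C\<close>: \<open>s c p\<close> is \<open>1\<close> or \<open>-1\<close> according to whether the
  coordinate basis of the chart \<open>c\<close> at \<open>p\<close> is positively or negatively oriented.\<close>

definition orientation_on ::
  "'m atlas \<Rightarrow> 'm set \<Rightarrow> (('m, real \<times> real) chart \<Rightarrow> 'm \<Rightarrow> real) \<Rightarrow> bool" where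
  "orientation_on A C s \<longleftrightarrow>
    (\<forall>c\<in>A. \<forall>p\<in>chart_dom c \<inter> C. s c p \<in> {-1, 1}) \<and>
    (\<forall>c\<in>A. continuous_on (chart_map c ` (chart_dom c \<inter> C)) (\<lambda>x. s c (chart_inv c x))) \<and>
    (\<forall>c\<in>A. \<forall>d\<in>A. \<forall>p\<in>chart_dom c \<inter> chart_dom d \<inter> C.
      s c p = s d p * sgn (dx_wedge_dy (local_differential c d id p (1, 0))
                                       (local_differential c d id p (0, 1))))"

text \<open>\<open>has_form_integral A s w S r\<close>: the integral of \<open>w\<close> over \<open>S\<close> with respect to the orientation
  \<open>s\<close> exists and is \<open>r\<close>, possibly infinite. The set \<open>S\<close> is cut into countably many
  pieces lying in single charts; by the change of variables formula \<open>r\<close> does not depend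
  on how this is done. Since \<open>ennreal\<close> sends negative numbers to \<open>0\<close>, \<open>I 1\<close> and \<open>I (-1)\<close> are the
  integrals of the positive and of the negative part.\<close>

definition has_form_integral ::
  "'m atlas \<Rightarrow> (('m, real \<times> real) chart \<Rightarrow> 'm \<Rightarrow> real) \<Rightarrow> 'm local_forms \<Rightarrow> 'm set \<Rightarrow> ereal \<Rightarrow> bool"
  where "has_form_integral A s w S r \<longleftrightarrow>
    (\<exists>(c :: nat \<Rightarrow> ('m, real \<times> real) chart) T.
      (\<forall>i. c i \<in> A \<and> T i \<subseteq> chart_dom (c i) \<and> chart_map (c i) ` T i \<in> sets borel) \<and>
      disjoint_family T \<and> (\<Union>i. T i) = S \<and>
      (let I = \<lambda>\<epsilon>::real. \<Sum>i. \<integral>\<^sup>+x\<in>chart_map (c i) ` T i.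
               (let p = chart_inv (c i) x in
                 ennreal (\<epsilon> * (s (c i) p * w (c i) p (1, 0) (0, 1)))) \<partial>lborel
       in \<not> (I 1 = \<infinity> \<and> I (-1) = \<infinity>) \<and> r = enn2ereal (I 1) - enn2ereal (I (-1))))"

text \<open>\<open>is_form_measure A w M\<close>: the Borel measure \<open>M\<close> is the measure determined by the form \<open>w\<close>.\<close>

definition is_form_measure :: "'m atlas \<Rightarrow> 'm local_forms \<Rightarrow> 'm measure \<Rightarrow> bool" where
  "is_form_measure A w M \<longleftrightarrow>
    space M = surface_points A \<and>
    sets M = sigma_sets (surface_points A) {S. openin (surface_topology A) S} \<and>
    (\<forall>C\<in>connected_components_of (surface_topology A). \<exists>s. orientation_on A C s \<and>
      (\<forall>S. openin (surface_topology A) S \<and> S \<subseteq> C \<longrightarrow>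
        (\<exists>r. has_form_integral A s w S r \<and> emeasure M S = e2ennreal \<bar>r\<bar>)))"

section \<open>Framed one-dimensional continued fractions\<close>

definition RP1 :: "(real ^ 2) set set" where
  "RP1 = {L. subspace L \<and> dim L = 1}"

definition FCF1 :: "((real ^ 2) set \<times> (real ^ 2) set) set" where
  "FCF1 = RP1 \<times> RP1 - Id_on RP1"

definition line_with_coordinate :: "(real ^ 2) set \<Rightarrow> (real ^ 2 \<Rightarrow> real) \<Rightarrow> bool" where
  "line_with_coordinate l \<xi> \<longleftrightarrow>
    (\<exists>a e. norm e = 1 \<and> l = range (\<lambda>t. a + t *\<^sub>R e) \<and> (\<forall>t. \<xi> (a + t *\<^sub>R e) = t))"

definition RP1_chart :: "(real ^ 2) set \<Rightarrow> (real ^ 2 \<Rightarrow> real) \<Rightarrow> ((real ^ 2) set, real) chart" where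
  "RP1_chart l \<xi> = ({L \<in> RP1. L \<inter> l \<noteq> {}}, \<lambda>L. \<xi> (the_elem (L \<inter> l)))"

definition RP1_atlas :: "((real ^ 2) set, real) chart set" where
  "RP1_atlas = {RP1_chart l \<xi> | l \<xi>. line_with_coordinate l \<xi> \<and> 0 \<notin> l}"

text \<open>A product chart of \<open>RP1 \<times> RP1\<close>, restricted to the open subset \<open>FCF1\<close>.\<close>

definition FCF1_product_chart ::
  "((real ^ 2) set, real) chart \<Rightarrow> ((real ^ 2) set, real) chart \<Rightarrow>
    ((real ^ 2) set \<times> (real ^ 2) set, real \<times> real) chart" where
  "FCF1_product_chart c d =
    ((chart_dom c \<times> chart_dom d) \<inter> FCF1, map_prod (chart_map c) (chart_map d))"

definition FCF1_atlas :: "((real ^ 2) set \<times> (real ^ 2) set) atlas" where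
  "FCF1_atlas = {FCF1_product_chart c d | c d. c \<in> RP1_atlas \<and> d \<in> RP1_atlas}"

text \<open>The chart with the coordinates \<open>(x\<^sub>l, y\<^sub>l)\<close>; its domain is the open subset of the pairs in
  \<open>FCF1\<close> such that both lines intersect \<open>l\<close>.\<close>

definition FCF1_chart :: "(real ^ 2) set \<Rightarrow> (real ^ 2 \<Rightarrow> real) \<Rightarrow>
    ((real ^ 2) set \<times> (real ^ 2) set, real \<times> real) chart" where
  "FCF1_chart l \<xi> = FCF1_product_chart (RP1_chart l \<xi>) (RP1_chart l \<xi>)"

definition omega :: "((real ^ 2) set \<times> (real ^ 2) set) local_forms" where
  "omega c p u v = (let (x, y) = chart_map c p in dx_wedge_dy u v / \<bar>x - y\<bar>\<^sup>2)"

section \<open>Moebius forms and Moebius measures\<close>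

definition GL2 :: "(real ^ 2 ^ 2) monoid" where
  "GL2 = \<lparr>carrier = {A. invertible A}, mult = (**), one = mat 1\<rparr>"

definition PGL2 :: "(real ^ 2 ^ 2) set monoid" where
  "PGL2 = GL2 Mod {k *\<^sub>R mat 1 | k. k \<noteq> 0}"

text \<open>All matrices in an element of \<open>PGL2\<close> map a line through the origin to the same line, so the
  union below is just that line.\<close>

definition PGL2_line :: "(real ^ 2 ^ 2) set \<Rightarrow> (real ^ 2) set \<Rightarrow> (real ^ 2) set" where
  "PGL2_line g L = (\<Union>A\<in>g. (*v) A ` L)"

definition PGL2_action :: "(real ^ 2 ^ 2) set \<Rightarrow>
    (real ^ 2) set \<times> (real ^ 2) set \<Rightarrow> (real ^ 2) set \<times> (real ^ 2) set" where
  "PGL2_action g = map_prod (PGL2_line g) (PGL2_line g)"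

definition moebius_form :: "((real ^ 2) set \<times> (real ^ 2) set) local_forms \<Rightarrow> bool" where
  "moebius_form w \<longleftrightarrow> top_form FCF1_atlas w \<and>
    (\<forall>g\<in>carrier PGL2. form_invariant FCF1_atlas (PGL2_action g) w)"

definition moebius_measure :: "((real ^ 2) set \<times> (real ^ 2) set) measure \<Rightarrow> bool" where
  "moebius_measure M \<longleftrightarrow> (\<exists>w. moebius_form w \<and> is_form_measure FCF1_atlas w M)"

end

theory Submission
  imports Defs
begin

text \<open>Write \<open>[u, v]\<close> for the determinant of two vectors of the plane. If a line \<open>l\<close> is parametrised by
  \<open>u(x) = a + x e\<close>, then \<open>[u(x), u(y)] = [a, e] (y - x)\<close>, so that \<open>\<omega>\<^sub>l\<close> is
  \<open>[a, e] dx \<and> [a, e] dy / [u(x), u(y)]\<^sup>2\<close>. In this shape the formula makes sense for a product chart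
  in which the two lines of a pair are intersected with different lines \<open>a + x e\<close> and \<open>b + y f\<close>:
  \<open>[a, e] dx \<and> [b, f] dy / [u(x), v(y)]\<^sup>2\<close>. Here \<open>[a, e] dx = [u, du]\<close>, and if \<open>u\<close> is replaced by a
  multiple \<open>k u\<close>, with \<open>k\<close> depending on \<open>x\<close>, then \<open>[u, du]\<close> is multiplied by \<open>k\<^sup>2\<close>. Hence the quotient
  depends only on the two lines spanned by \<open>u\<close> and \<open>v\<close>, not on the chart; and a linear map \<open>A\<close>
  multiplies numerator and denominator by \<open>(det A)\<^sup>2\<close>, whatever the sign of \<open>det A\<close>. This gives a
  Moebius form on the whole of \<open>FCF1\<close> (\<open>moebius_transition\<close>, \<open>moebius_form_invariant_form\<close>) which is
  \<open>\<omega>\<^sub>l\<close> in the chart of \<open>l\<close> (\<open>moebius_density_chart\<close>, \<open>moebius_density_same\<close>).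

  The measure of this form is obtained without a change of variables. A pair of lines is missing from
  the chart of \<open>l\<close> only if one of its lines is parallel to \<open>l\<close>, and in suitable other charts these pairs
  lie on a coordinate axis (\<open>chart_decomposition\<close>), a null set. So the image of
  \<open>dx dy / (x - y)\<^sup>2\<close> under the inverse of the chart of \<open>l\<close> (\<open>chart_measure\<close>) already is the measure of
  the global form (\<open>form_measure_invariant_form\<close>). An orientation is needed only to give meaning to the
  integrals; the sign of \<open>[a, e] [b, f]\<close> is one, and the form is positive for it.

  Restricted to the chart, this measure is a measure determined by \<open>\<omega>\<^sub>l\<close> (\<open>form_measure_omega\<close>). It is
  the only one (\<open>form_measure_omega_unique\<close>): a coordinate box is connected, so it lies in one component
  and every orientation is constant on it, which fixes its measure up to a sign removed by the absolute
  value; the boxes whose closure avoids the diagonal are stable under intersection, generate the Borel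
  sets and have finite measure.\<close>

section \<open>Lines of the plane and the charts cutting them\<close>

definition area :: "real ^ 2 \<Rightarrow> real ^ 2 \<Rightarrow> real" where
  "area u v = u $ 1 * v $ 2 - u $ 2 * v $ 1"

lemma area_simps [simp]:
  "area u u = 0" "area (u + v) w = area u w + area v w" "area u (v + w) = area u v + area u w"
  "area (k *\<^sub>R u) v = k * area u v" "area u (k *\<^sub>R v) = k * area u v"
  "area 0 u = 0" "area u 0 = 0"
  by (simp_all add: area_def algebra_simps)

lemma area_commute: "area v u = - area u v"
  by (simp add: area_def)

lemma area_matrix: "area (A *v u) (A *v v) = det A * area u v"
  by (simp add: area_def det_2 matrix_vector_mult_def sum_2) algebra

text \<open>The Pluecker relation. It is the numerator of the derivative of a quotient of two areas that
  depend linearly on a parameter.\<close>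

lemma area_pluecker: "area s t * area u v - area s u * area t v = area s v * area u t"
  by (simp add: area_def) algebra

lemma continuous_on_area [continuous_intros]:
  assumes "continuous_on S f" "continuous_on S g"
  shows "continuous_on S (\<lambda>x. area (f x) (g x))"
  unfolding area_def by (intro continuous_intros assms)

lemma area_eq_0_iff:
  assumes "v \<noteq> 0"
  shows "area u v = 0 \<longleftrightarrow> (\<exists>k. u = k *\<^sub>R v)"
proof
  assume 0: "area u v = 0"
  have "u = (if v $ 1 = 0 then u $ 2 / v $ 2 else u $ 1 / v $ 1) *\<^sub>R v"
    using assms 0 by (auto simp: vec_eq_iff forall_2 area_def field_simps)
  then show "\<exists>k. u = k *\<^sub>R v" ..
qed auto

lemma span_singleton_eq_iff_area:
  assumes "u \<noteq> 0" "v \<noteq> 0"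
  shows "span {u} = span {v} \<longleftrightarrow> area u v = 0"
proof
  assume "span {u} = span {v}"
  then have "u \<in> span {v}" by (metis insertI1 span_superset subset_iff)
  then show "area u v = 0" by (auto simp: span_singleton)
next
  assume "area u v = 0"
  then obtain k where k: "u = k *\<^sub>R v" using assms area_eq_0_iff by blast
  then have "v = (1 / k) *\<^sub>R u" using assms by auto
  then have "v \<in> span {u}" "u \<in> span {v}"
    using k by (metis insertI1 span_mul span_superset subset_iff)+
  then show "span {u} = span {v}" by (simp add: span_eq)
qed

lemma RP1_eq: "RP1 = {span {v} | v. v \<noteq> 0}"
proof -
  have "\<exists>v. L = span {v} \<and> v \<noteq> 0" if L: "subspace L" "dim L = 1" for L :: "(real ^ 2) set"
  proof -
    obtain B where B: "B \<subseteq> L" "independent B" "L \<subseteq> span B" "card B = dim L"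
      using basis_exists by blast
    then obtain v where "B = {v}" using L(2) by (metis card_1_singletonE)
    then show ?thesis
      using B L(1) by (metis dependent_zero insertI1 span_minimal subset_antisym)
  qed
  then show ?thesis
    by (auto simp: RP1_def)
qed

lemma FCF1_eq: "FCF1 = {(span {u}, span {v}) | u v. area u v \<noteq> 0}"
proof -
  have eq: "u \<noteq> 0 \<and> v \<noteq> 0 \<and> span {u} \<noteq> span {v} \<longleftrightarrow> area u v \<noteq> 0" for u v
    by (cases "u = 0 \<or> v = 0") (auto simp: span_singleton_eq_iff_area)
  have "FCF1 = {(span {u}, span {v}) | u v. u \<noteq> 0 \<and> v \<noteq> 0 \<and> span {u} \<noteq> span {v}}"
    unfolding FCF1_def RP1_eq Id_on_def by blast
  then show ?thesis
    unfolding eq .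
qed

text \<open>A frame \<open>(a, e)\<close> stands for the parametrised line \<open>a + t e\<close>. The area of
  the frame is nonzero exactly when this is a genuine line (\<open>e \<noteq> 0\<close>) avoiding the origin.\<close>

type_synonym frame = "(real ^ 2) \<times> (real ^ 2)"
type_synonym line_pair = "(real ^ 2) set \<times> (real ^ 2) set"

definition frame_area :: "frame \<Rightarrow> real" where
  "frame_area F = area (fst F) (snd F)"

definition point :: "frame \<Rightarrow> real \<Rightarrow> real ^ 2" where
  "point F t = fst F + t *\<^sub>R snd F"

text \<open>The parameter of the point in which the line spanned by \<open>v\<close> meets the line of the frame, by
  Cramer's rule; it is invariant under scaling of \<open>v\<close>.\<close>

definition coordinate :: "frame \<Rightarrow> real ^ 2 \<Rightarrow> real" where
  "coordinate F v = area (fst F) v / area v (snd F)"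

lemma area_point [simp]: "area (point F t) (snd F) = frame_area F"
  by (simp add: point_def frame_area_def)

lemma coordinate_point [simp]: "frame_area F \<noteq> 0 \<Longrightarrow> coordinate F (point F t) = t"
  by (simp add: point_def frame_area_def coordinate_def)

lemma point_coordinate:
  assumes "frame_area F \<noteq> 0" "area v (snd F) \<noteq> 0"
  shows "point F (coordinate F v) = (frame_area F / area v (snd F)) *\<^sub>R v"
proof -
  have "area v (snd F) *\<^sub>R point F (coordinate F v)
      = area v (snd F) *\<^sub>R fst F + area (fst F) v *\<^sub>R snd F"
    using assms(2) by (simp add: point_def coordinate_def scaleR_add_right)
  also have "\<dots> = frame_area F *\<^sub>R v"
    by (simp add: vec_eq_iff forall_2 frame_area_def area_def algebra_simps)
  finally show ?thesis
    using assms(2) by (metis divide_inverse_commute divideR_right scaleR_scaleR)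
qed

lemma span_point_coordinate:
  assumes "frame_area F \<noteq> 0" "area v (snd F) \<noteq> 0"
  shows "span {point F (coordinate F v)} = span {v}"
proof -
  have "frame_area F / area v (snd F) \<noteq> 0" "v \<noteq> 0" using assms by auto
  then show ?thesis
    by (subst span_singleton_eq_iff_area) (auto simp: point_coordinate[OF assms])
qed

lemma span_inter_line:
  assumes F: "frame_area F \<noteq> 0" and v: "v \<noteq> 0"
  shows "span {v} \<inter> range (point F) =
    (if area v (snd F) = 0 then {} else {point F (coordinate F v)})"
proof -
  have "area v (snd F) \<noteq> 0 \<and> t = coordinate F v" if "point F t = k *\<^sub>R v" for t k
  proof -
    have "k * area v (snd F) = frame_area F" using that area_point[of F t] by simp
    then have n: "area v (snd F) \<noteq> 0" "k \<noteq> 0" using F by auto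
    then have "t = coordinate F (k *\<^sub>R v)" using that F by (metis coordinate_point)
    also have "\<dots> = coordinate F v" using n by (simp add: coordinate_def)
    finally show ?thesis using n by simp
  qed
  moreover have "point F (coordinate F v) \<in> span {v}" if "area v (snd F) \<noteq> 0"
    using point_coordinate[OF F that] by (simp add: span_mul span_base)
  moreover have "\<exists>k. w = k *\<^sub>R v" if "w \<in> span {v}" for w
    using that by (auto simp: span_singleton)
  ultimately show ?thesis
    by (cases "area v (snd F) = 0") (simp; blast)+
qed

definition region :: "frame \<Rightarrow> frame \<Rightarrow> (real \<times> real) set" where
  "region F G = {z. area (point F (fst z)) (point G (snd z)) \<noteq> 0}"

definition pair_at :: "frame \<Rightarrow> frame \<Rightarrow> real \<times> real \<Rightarrow> line_pair" where
  "pair_at F G z = (span {point F (fst z)}, span {point G (snd z)})"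

text \<open>The maps of two charts with the same domain may differ outside it, and the line \<open>l\<close> is not part of
  the data of a chart. This predicate keeps what the computations need: inverse to the chart is the
  explicit map \<open>pair_at F G\<close>.\<close>

definition framed ::
  "(line_pair, real \<times> real) chart \<Rightarrow> frame \<Rightarrow> frame \<Rightarrow> bool" where
  "framed c F G \<longleftrightarrow> frame_area F \<noteq> 0 \<and> frame_area G \<noteq> 0 \<and> chart_dom c = pair_at F G ` region F G \<and>
    (\<forall>z\<in>region F G. chart_map c (pair_at F G z) = z)"

lemma open_region: "open (region F G)"
proof -
  have "continuous_on UNIV (\<lambda>z. area (point F (fst z)) (point G (snd z)))"
    unfolding point_def by (intro continuous_intros)
  then show ?thesis
    unfolding region_def using open_Collect_neq[OF _ continuous_on_const] by auto
qed

lemma pair_at_coordinates: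
  assumes "frame_area F \<noteq> 0" "frame_area G \<noteq> 0" "area u v \<noteq> 0" "area u (snd F) \<noteq> 0" "area v (snd G) \<noteq> 0"
  shows "(coordinate F u, coordinate G v) \<in> region F G"
    "pair_at F G (coordinate F u, coordinate G v) = (span {u}, span {v})"
proof -
  have "area (point F (coordinate F u)) (point G (coordinate G v)) \<noteq> 0"
    using assms by (simp add: point_coordinate)
  then show "(coordinate F u, coordinate G v) \<in> region F G"
    by (simp add: region_def)
  show "pair_at F G (coordinate F u, coordinate G v) = (span {u}, span {v})"
    using assms by (simp add: pair_at_def span_point_coordinate)
qed

text \<open>A line meets the line of a frame unless it is parallel to it.\<close>

lemma framed_mem_iff:
  assumes c: "framed c F G" and uv: "area u v \<noteq> 0"
  shows "(span {u}, span {v}) \<in> chart_dom c \<longleftrightarrow> area u (snd F) \<noteq> 0 \<and> area v (snd G) \<noteq> 0"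
proof
  have nz: "u \<noteq> 0" "v \<noteq> 0" using uv by auto
  assume "(span {u}, span {v}) \<in> chart_dom c"
  then obtain x y where "area (point F x) (point G y) \<noteq> 0"
      "span {u} = span {point F x}" "span {v} = span {point G y}"
    using c by (auto simp: framed_def pair_at_def region_def)
  moreover then have "area (point F x) u = 0" "area (point G y) v = 0" "point F x \<noteq> 0" "point G y \<noteq> 0"
    using nz by (metis area_simps(6,7) span_singleton_eq_iff_area)+
  ultimately obtain k m where "point F x = k *\<^sub>R u" "point G y = m *\<^sub>R v"
    using nz by (metis area_eq_0_iff)
  then have "k * area u (snd F) = frame_area F" "m * area v (snd G) = frame_area G"
    by (metis area_point area_simps(4))+
  then show "area u (snd F) \<noteq> 0 \<and> area v (snd G) \<noteq> 0"
    using c by (auto simp: framed_def)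
next
  assume "area u (snd F) \<noteq> 0 \<and> area v (snd G) \<noteq> 0"
  then show "(span {u}, span {v}) \<in> chart_dom c"
    using c pair_at_coordinates[of F G u v] uv unfolding framed_def by (metis image_eqI)
qed

lemma framed_map:
  assumes c: "framed c F G" and uv: "area u v \<noteq> 0" "area u (snd F) \<noteq> 0" "area v (snd G) \<noteq> 0"
  shows "chart_map c (span {u}, span {v}) = (coordinate F u, coordinate G v)"
proof -
  have "frame_area F \<noteq> 0" "frame_area G \<noteq> 0" and c: "\<And>z. z \<in> region F G \<Longrightarrow> chart_map c (pair_at F G z) = z"
    using c by (simp_all add: framed_def)
  from pair_at_coordinates[OF this(1,2) uv] show ?thesis
    using c by metis
qed

lemma framed_inj: "framed c F G \<Longrightarrow> inj_on (chart_map c) (chart_dom c)"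
  unfolding framed_def by (intro inj_onI) (metis imageE)

lemma framed_image: "framed c F G \<Longrightarrow> chart_map c ` chart_dom c = region F G"
  by (simp add: framed_def image_image)

lemma framed_inv:
  assumes "framed c F G" "z \<in> region F G"
  shows "chart_inv c z = pair_at F G z"
  unfolding chart_inv_def
  by (rule inv_into_f_eq[OF framed_inj[OF assms(1)]]) (use assms in \<open>simp_all add: framed_def\<close>)

lemma framed_dom_subset: "framed c F G \<Longrightarrow> chart_dom c \<subseteq> FCF1"
  unfolding framed_def FCF1_eq pair_at_def region_def by (simp add: image_subset_iff) blast

lemma line_with_coordinate_frame:
  assumes "line_with_coordinate l \<xi>" "0 \<notin> l"
  obtains F where "frame_area F \<noteq> 0" "l = range (point F)" "\<And>t. \<xi> (point F t) = t" "norm (snd F) = 1"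
proof -
  obtain a e where ae: "norm e = 1" "l = range (\<lambda>t. a + t *\<^sub>R e)" "\<And>t. \<xi> (a + t *\<^sub>R e) = t"
    using assms(1) unfolding line_with_coordinate_def by blast
  have "area a e \<noteq> 0"
  proof
    assume "area a e = 0"
    moreover have "e \<noteq> 0" using ae(1) by auto
    ultimately obtain k where "a = k *\<^sub>R e" using area_eq_0_iff by blast
    then have "a + (- k) *\<^sub>R e = 0" by simp
    then have "0 \<in> l" unfolding ae(2) by (metis rangeI)
    then show False using assms(2) by blast
  qed
  then show ?thesis
    using that[of "(a, e)"] ae by (simp add: frame_area_def point_def[abs_def])
qed

lemma product_chart_framed:
  assumes F: "frame_area F \<noteq> 0" "l = range (point F)" "\<And>t. \<xi> (point F t) = t"
    and G: "frame_area G \<noteq> 0" "m = range (point G)" "\<And>t. \<eta> (point G t) = t"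
  shows "framed (FCF1_product_chart (RP1_chart l \<xi>) (RP1_chart m \<eta>)) F G"
proof -
  let ?c = "FCF1_product_chart (RP1_chart l \<xi>) (RP1_chart m \<eta>)"
  have dom: "(span {u}, span {v}) \<in> chart_dom ?c \<longleftrightarrow> area u (snd F) \<noteq> 0 \<and> area v (snd G) \<noteq> 0"
    if "area u v \<noteq> 0" for u v
  proof -
    have "u \<noteq> 0" "v \<noteq> 0" using that by auto
    then show ?thesis
      using that span_inter_line[OF F(1), of u] span_inter_line[OF G(1), of v]
      by (auto simp: FCF1_product_chart_def RP1_chart_def F(2) G(2) FCF1_eq RP1_eq)
  qed
  have sub: "chart_dom ?c \<subseteq> FCF1"
    by (simp add: FCF1_product_chart_def)
  have "chart_dom ?c = pair_at F G ` region F G"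
  proof
    show "pair_at F G ` region F G \<subseteq> chart_dom ?c"
      using F(1) G(1) by (auto simp: pair_at_def region_def dom)
    show "chart_dom ?c \<subseteq> pair_at F G ` region F G"
    proof
      fix p assume p: "p \<in> chart_dom ?c"
      then obtain u v where uv: "p = (span {u}, span {v})" "area u v \<noteq> 0"
        using sub by (auto simp: FCF1_eq)
      then show "p \<in> pair_at F G ` region F G"
        using pair_at_coordinates[OF F(1) G(1) uv(2)] p dom[OF uv(2)] by (metis image_eqI)
    qed
  qed
  moreover have "chart_map ?c (pair_at F G z) = z" if "z \<in> region F G" for z
  proof -
    have "point F (fst z) \<noteq> 0" "point G (snd z) \<noteq> 0"
      using F(1) G(1) by (metis area_point area_simps(6))+
    then have "span {point F (fst z)} \<inter> l = {point F (fst z)}"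
       "span {point G (snd z)} \<inter> m = {point G (snd z)}"
      using F G by (simp_all add: span_inter_line)
    then show ?thesis
      by (simp add: FCF1_product_chart_def RP1_chart_def pair_at_def F G)
  qed
  ultimately show ?thesis
    using F(1) G(1) by (simp add: framed_def)
qed

lemma FCF1_atlas_framed:
  assumes "c \<in> FCF1_atlas"
  obtains F G where "framed c F G"
proof -
  from assms obtain l \<xi> m \<eta> where c: "c = FCF1_product_chart (RP1_chart l \<xi>) (RP1_chart m \<eta>)"
    and l: "line_with_coordinate l \<xi>" "0 \<notin> l" and m: "line_with_coordinate m \<eta>" "0 \<notin> m"
    unfolding FCF1_atlas_def RP1_atlas_def by blast
  obtain F where F: "frame_area F \<noteq> 0" "l = range (point F)" "\<And>t. \<xi> (point F t) = t"
    using line_with_coordinate_frame[OF l] by blast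
  obtain G where G: "frame_area G \<noteq> 0" "m = range (point G)" "\<And>t. \<eta> (point G t) = t"
    using line_with_coordinate_frame[OF m] by blast
  show ?thesis
    using that product_chart_framed[OF F G] c by simp
qed

section \<open>The invariant form\<close>

definition moebius_density :: "frame \<Rightarrow> frame \<Rightarrow> real \<times> real \<Rightarrow> real" where
  "moebius_density F G z =
    frame_area F * frame_area G / (area (point F (fst z)) (point G (snd z)))\<^sup>2"

text \<open>The derivative of the fractional linear map which takes the coordinate of a line with respect to
  \<open>F\<close> to the coordinate of its image under \<open>A\<close> with respect to \<open>F'\<close>.\<close>

definition stretch :: "real ^ 2 ^ 2 \<Rightarrow> frame \<Rightarrow> frame \<Rightarrow> real \<Rightarrow> real" where
  "stretch A F F' t = frame_area F' * det A * frame_area F / (area (A *v point F t) (snd F'))\<^sup>2"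

definition acts_as ::
  "(line_pair \<Rightarrow> line_pair) \<Rightarrow> real ^ 2 ^ 2 \<Rightarrow> bool" where
  "acts_as g A \<longleftrightarrow> invertible A \<and>
    (\<forall>u v. area u v \<noteq> 0 \<longrightarrow> g (span {u}, span {v}) = (span {A *v u}, span {A *v v}))"

lemma acts_as_id: "acts_as id (mat 1)"
  by (simp add: acts_as_def invertible_det_nz)

lemma matrix_point: "A *v point F t = A *v fst F + t *\<^sub>R (A *v snd F)"
  by (simp add: point_def matrix_vector_right_distrib matrix_vector_mult_scaleR)

lemma coordinate_has_derivative:
  assumes "area (A *v point F t) (snd F') \<noteq> 0"
  shows "((\<lambda>t. coordinate F' (A *v point F t)) has_real_derivative stretch A F F' t) (at t)"
proof -
  let ?a = "A *v fst F" and ?e = "A *v snd F"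
  have "((\<lambda>t. coordinate F' (A *v point F t)) has_real_derivative
      (area (fst F') ?e * area (A *v point F t) (snd F')
        - area (fst F') (A *v point F t) * area ?e (snd F'))
      / (area (A *v point F t) (snd F') * area (A *v point F t) (snd F'))) (at t)"
    using assms unfolding coordinate_def matrix_point area_simps
    by (auto intro!: derivative_eq_intros)
  also have "area (fst F') ?e * area (A *v point F t) (snd F')
        - area (fst F') (A *v point F t) * area ?e (snd F')
      = frame_area F' * area (A *v point F t) ?e"
    by (simp add: area_pluecker frame_area_def)
  also have "area (A *v point F t) ?e = det A * frame_area F"
    by (simp add: area_matrix)
  finally show ?thesis
    by (simp add: stretch_def power2_eq_square mult.assoc)
qed

text \<open>Transition maps (\<open>A = 1\<close>, \<open>g = id\<close>) and the action of matrices are treated at once. Each of the two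
  lines moves by its own fractional linear map, so the differential is diagonal. In the product of the
  density with \<open>\<alpha> \<beta>\<close>, the areas of \<open>A u\<close> and \<open>A v\<close> with the directions of the new frames cancel, because the
  points of the new frames are \<open>A u\<close> and \<open>A v\<close> rescaled by these areas (\<open>point_coordinate\<close>); the factor
  \<open>(det A)\<^sup>2\<close> cancels too.\<close>

lemma moebius_transition:
  assumes c: "framed c F G" and d: "framed d F' G'" and g: "acts_as g A"
    and p: "p \<in> chart_dom c" "g p \<in> chart_dom d"
  defines "\<alpha> \<equiv> stretch A F F' (fst (chart_map c p))" and "\<beta> \<equiv> stretch A G G' (snd (chart_map c p))"
  shows "local_differential c d g p = (\<lambda>w. (\<alpha> * fst w, \<beta> * snd w))" (is ?differential)
    and "moebius_density F' G' (chart_map d (g p)) * (\<alpha> * \<beta>) = moebius_density F G (chart_map c p)"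
      (is ?density)
    and "area (A *v point F (fst (chart_map c p))) (snd F') \<noteq> 0"
    and "area (A *v point G (snd (chart_map c p))) (snd G') \<noteq> 0"
proof -
  have det: "det A \<noteq> 0" using g by (simp add: acts_as_def invertible_det_nz)
  obtain z where z: "z \<in> region F G" and pz: "p = pair_at F G z" and cz: "chart_map c p = z"
    using c p(1) by (auto simp: framed_def)
  \<comment> \<open>\<open>S\<close> is an open neighbourhood of \<open>z\<close> on which \<open>g\<close> is given by the fractional linear maps.\<close>
  define S where "S = {z. area (A *v point F (fst z)) (snd F') \<noteq> 0 \<and>
      area (A *v point G (snd z)) (snd G') \<noteq> 0} \<inter> region F G"
  have area_A: "area (A *v point F (fst z)) (A *v point G (snd z)) \<noteq> 0" if "z \<in> region F G" for z
    using that det by (simp add: area_matrix region_def)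
  have g_pair: "g (pair_at F G z) = (span {A *v point F (fst z)}, span {A *v point G (snd z)})"
    if "z \<in> region F G" for z
    using that g by (simp add: acts_as_def pair_at_def region_def)
  have map_S: "chart_map d (g (pair_at F G z)) =
      (coordinate F' (A *v point F (fst z)), coordinate G' (A *v point G (snd z)))"
    if "z \<in> S" for z
    using that g_pair[of z] area_A[of z] framed_map[OF d] by (simp add: S_def)
  have zS: "z \<in> S"
    using p(2) framed_mem_iff[OF d area_A[OF z]] z unfolding pz g_pair[OF z] S_def by simp
  then show nz: "area (A *v point F (fst (chart_map c p))) (snd F') \<noteq> 0"
    "area (A *v point G (snd (chart_map c p))) (snd G') \<noteq> 0"
    by (simp_all add: S_def cz)
  have "continuous_on UNIV (\<lambda>z. area (A *v point F (fst z)) (snd F'))"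
    "continuous_on UNIV (\<lambda>z. area (A *v point G (snd z)) (snd G'))"
    unfolding matrix_point by (intro continuous_intros)+
  then have "open S"
    unfolding S_def
    by (intro open_Int open_region open_Collect_conj) (auto intro!: open_Collect_neq)
  have "((\<lambda>z. (coordinate F' (A *v point F (fst z)), coordinate G' (A *v point G (snd z))))
      has_derivative (\<lambda>w. (\<alpha> * fst w, \<beta> * snd w))) (at z)"
    using coordinate_has_derivative[OF nz(1)] coordinate_has_derivative[OF nz(2)]
    unfolding cz \<alpha>_def \<beta>_def has_field_derivative_def
    by (intro has_derivative_Pair)
      (auto intro: has_derivative_compose[OF has_derivative_fst[OF has_derivative_ident]]
        has_derivative_compose[OF has_derivative_snd[OF has_derivative_ident]])
  moreover have "(coordinate F' (A *v point F (fst z)), coordinate G' (A *v point G (snd z)))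
      = (chart_map d \<circ> g \<circ> chart_inv c) z" if "z \<in> S" for z
    using that map_S[OF that] framed_inv[OF c] by (simp add: S_def)
  ultimately have "((chart_map d \<circ> g \<circ> chart_inv c)
      has_derivative (\<lambda>w. (\<alpha> * fst w, \<beta> * snd w))) (at z)"
    using has_derivative_transform_within_open \<open>open S\<close> zS by blast
  then show ?differential
    unfolding local_differential_def cz by (rule frechet_derivative_at[symmetric])
  let ?s = "area (A *v point F (fst z)) (snd F')" and ?t = "area (A *v point G (snd z)) (snd G')"
  let ?r = "area (point F (fst z)) (point G (snd z))"
  have fr: "frame_area F \<noteq> 0" "frame_area G \<noteq> 0" "frame_area F' \<noteq> 0" "frame_area G' \<noteq> 0"
    using c d by (simp_all add: framed_def)
  have "?s \<noteq> 0" "?t \<noteq> 0" "?r \<noteq> 0"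
    using zS by (simp_all add: S_def region_def)
  moreover from this have "area (point F' (fst (chart_map d (g p)))) (point G' (snd (chart_map d (g p)))) =
      frame_area F' / ?s * (frame_area G' / ?t * (det A * ?r))"
    using fr by (simp add: pz map_S[OF zS] point_coordinate area_matrix mult_ac)
  ultimately show ?density
    using fr det unfolding moebius_density_def cz \<alpha>_def \<beta>_def stretch_def
    by (simp only:) (simp add: field_simps power2_eq_square)
qed

text \<open>The form below is a function of the chart, so frames must be recovered from it. Different choices
  lead to the same form by \<open>moebius_density_chart\<close>.\<close>

definition frames_of :: "(line_pair, real \<times> real) chart \<Rightarrow> frame \<times> frame" where
  "frames_of c = (SOME FG. framed c (fst FG) (snd FG))"

lemma framed_frames_of:
  assumes "c \<in> FCF1_atlas"
  shows "framed c (fst (frames_of c)) (snd (frames_of c))"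
proof -
  obtain F G where "framed c F G" using FCF1_atlas_framed[OF assms] .
  then show ?thesis
    unfolding frames_of_def by (metis (mono_tags, lifting) someI fst_conv snd_conv)
qed

definition invariant_form :: "line_pair local_forms" where
  "invariant_form c p u v =
    moebius_density (fst (frames_of c)) (snd (frames_of c)) (chart_map c p) * dx_wedge_dy u v"

lemma form_invariant_invariant_form:
  assumes g: "acts_as g A"
  shows "form_invariant FCF1_atlas g invariant_form"
  unfolding form_invariant_def
proof (intro ballI allI impI)
  fix c d p u v
  assume c: "c \<in> FCF1_atlas" and d: "d \<in> FCF1_atlas" and p: "p \<in> chart_dom c" "g p \<in> chart_dom d"
  note tr = moebius_transition[OF framed_frames_of[OF c] framed_frames_of[OF d] g p]
  show "invariant_form d (g p) (local_differential c d g p u) (local_differential c d g p v) =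
      invariant_form c p u v"
    unfolding invariant_form_def dx_wedge_dy_def tr(1) tr(2)[symmetric]
    by (simp add: algebra_simps)
qed

text \<open>The matrices in a coset of the scalar matrices all map \<open>u\<close> to multiples of \<open>A u\<close>.\<close>

lemma PGL2_line_span:
  assumes g: "g = {k *\<^sub>R mat 1 | k. k \<noteq> 0} #>\<^bsub>GL2\<^esub> A"
  shows "PGL2_line g (span {u}) = span {A *v u}"
proof -
  have "g = {(k *\<^sub>R mat 1) ** A | k. k \<noteq> 0}"
    unfolding g r_coset_def GL2_def by auto
  moreover have "((k *\<^sub>R mat 1) ** A) *v x = k *\<^sub>R (A *v x)" for k x
    by (simp add: matrix_vector_mul_assoc[symmetric] scaleR_matrix_vector_assoc[symmetric])
  ultimately have "PGL2_line g (span {u}) = {k *\<^sub>R A *v (m *\<^sub>R u) | k m. k \<noteq> 0}"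
    unfolding PGL2_line_def span_singleton by (auto simp: image_image scaleR_matrix_vector_assoc)
  also have "\<dots> = range (\<lambda>k. k *\<^sub>R (A *v u))"
  proof
    show "{k *\<^sub>R A *v (m *\<^sub>R u) | k m. k \<noteq> 0} \<subseteq> range (\<lambda>k. k *\<^sub>R (A *v u))"
      by (auto simp: matrix_vector_mult_scaleR scaleR_matrix_vector_assoc[symmetric])
    have "k *\<^sub>R (A *v u) = 1 *\<^sub>R A *v (k *\<^sub>R u)" for k
      by (simp add: matrix_vector_mult_scaleR)
    then show "range (\<lambda>k. k *\<^sub>R (A *v u)) \<subseteq> {k *\<^sub>R A *v (m *\<^sub>R u) | k m. k \<noteq> 0}"
      using zero_neq_one by (smt (verit) image_subset_iff mem_Collect_eq)
  qed
  finally show ?thesis by (simp add: span_singleton)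
qed

lemma PGL2_action_invariant:
  assumes "g \<in> carrier PGL2"
  shows "form_invariant FCF1_atlas (PGL2_action g) invariant_form"
proof -
  obtain A where A: "invertible A" and g: "g = {k *\<^sub>R mat 1 | k. k \<noteq> 0} #>\<^bsub>GL2\<^esub> A"
    using assms unfolding PGL2_def FactGroup_def RCOSETS_def by (auto simp: GL2_def)
  show ?thesis
    by (rule form_invariant_invariant_form[of _ A]) (simp add: acts_as_def A PGL2_action_def PGL2_line_span[OF g])
qed

text \<open>Smoothness of the density follows from closure properties of \<open>C_k_on\<close>. The derivatives in its
  definition are taken in the whole space, hence the restriction to open sets.\<close>

lemma C_k_on_cong:
  assumes "open S" "\<And>x. x \<in> S \<Longrightarrow> f x = g x"
  shows "C_k_on k f S \<longleftrightarrow> C_k_on k g S"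
  using assms(2)
proof (induction k arbitrary: f g)
  case 0
  then show ?case by (simp cong: continuous_on_cong)
next
  case (Suc k)
  have der: "(f has_derivative D) (at x) \<longleftrightarrow> (g has_derivative D) (at x)" if "x \<in> S" for x D
    using has_derivative_transform_within_open[OF _ assms(1) that] Suc.prems by (metis (no_types, lifting))
  then have "f differentiable (at x) \<longleftrightarrow> g differentiable (at x)"
    "frechet_derivative f (at x) = frechet_derivative g (at x)" if "x \<in> S" for x
    using that by (simp_all add: differentiable_def frechet_derivative_def)
  then show ?case
    using Suc.IH[of "\<lambda>x. frechet_derivative f (at x) v" "\<lambda>x. frechet_derivative g (at x) v" for v]
    by simp
qed

lemma C_k_on_SucI:
  assumes "open S" "\<And>x. x \<in> S \<Longrightarrow> (f has_derivative D x) (at x)" "\<And>v. C_k_on k (\<lambda>x. D x v) S"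
  shows "C_k_on (Suc k) f S"
proof -
  have "C_k_on k (\<lambda>x. frechet_derivative f (at x) v) S" for v
    using assms(3)[of v] frechet_derivative_at[OF assms(2)] 
      C_k_on_cong[OF assms(1), of "\<lambda>x. frechet_derivative f (at x) v" "\<lambda>x. D x v"] by simp
  then show ?thesis using assms(2) by (auto simp: differentiable_def)
qed

lemma C_k_on_Suc_imp: "C_k_on (Suc k) f S \<Longrightarrow> C_k_on k f S"
proof (induction k arbitrary: f)
  case 0
  then show ?case
    by (auto intro!: continuous_at_imp_continuous_on differentiable_imp_continuous_within)
next
  case (Suc k)
  then show ?case by (metis C_k_on.simps(2))
qed

lemma C_k_on_const: "open S \<Longrightarrow> C_k_on k (\<lambda>x. a) S"
proof (induction k arbitrary: a)
  case (Suc k)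
  then show ?case by (intro C_k_on_SucI[where D = "\<lambda>x v. 0"]) auto
qed simp

lemma C_k_on_linear:
  assumes "bounded_linear f" "open S"
  shows "C_k_on k f S"
proof (cases k)
  case 0
  then show ?thesis by (simp add: assms(1) linear_continuous_on)
next
  case (Suc m)
  show ?thesis unfolding Suc
    by (rule C_k_on_SucI[OF assms(2) bounded_linear_imp_has_derivative[OF assms(1)]])
      (rule C_k_on_const[OF assms(2)])
qed

lemma C_k_on_add:
  assumes "open S"
  shows "C_k_on k f S \<Longrightarrow> C_k_on k g S \<Longrightarrow> C_k_on k (\<lambda>x. f x + g x) S"
proof (induction k arbitrary: f g)
  case (Suc k)
  then have "(f has_derivative frechet_derivative f (at x)) (at x)"
    and "(g has_derivative frechet_derivative g (at x)) (at x)" if "x \<in> S" for x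
    using that unfolding frechet_derivative_works[symmetric] by simp_all
  then show ?case
    using Suc by (intro C_k_on_SucI[OF assms has_derivative_add]) auto
qed (simp add: continuous_on_add)

lemma C_k_on_mult:
  fixes f g :: "'a::real_normed_vector \<Rightarrow> real"
  assumes "open S"
  shows "C_k_on k f S \<Longrightarrow> C_k_on k g S \<Longrightarrow> C_k_on k (\<lambda>x. f x * g x) S"
proof (induction k arbitrary: f g)
  case (Suc k)
  then have "(f has_derivative frechet_derivative f (at x)) (at x)"
    and "(g has_derivative frechet_derivative g (at x)) (at x)" if "x \<in> S" for x
    using that unfolding frechet_derivative_works[symmetric] by simp_all
  then show ?case
    using Suc C_k_on_Suc_imp[OF Suc.prems(1)] C_k_on_Suc_imp[OF Suc.prems(2)]
    by (intro C_k_on_SucI[OF assms has_derivative_mult] C_k_on_add[OF assms]) auto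
qed (simp add: continuous_on_mult)

lemma C_k_on_inverse:
  fixes f :: "'a::real_normed_vector \<Rightarrow> real"
  assumes "open S" "\<And>x. x \<in> S \<Longrightarrow> f x \<noteq> 0"
  shows "C_k_on k f S \<Longrightarrow> C_k_on k (\<lambda>x. inverse (f x)) S"
proof (induction k)
  case (Suc k)
  then have "(f has_derivative frechet_derivative f (at x)) (at x)" if "x \<in> S" for x
    using that frechet_derivative_works by (metis C_k_on.simps(2))
  then have "((\<lambda>x. inverse (f x)) has_derivative
      (\<lambda>v. (-1) * (inverse (f x) * frechet_derivative f (at x) v * inverse (f x)))) (at x)" if "x \<in> S" for x
    using Deriv.has_derivative_inverse[of f x, OF assms(2)[OF that]] that by simp
  then show ?case
    using Suc.IH[OF C_k_on_Suc_imp[OF Suc.prems]] Suc.prems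
    by (intro C_k_on_SucI[where D = "\<lambda>x v. (-1) * (inverse (f x) * frechet_derivative f (at x) v * inverse (f x))"]
      assms(1) C_k_on_mult[OF assms(1)] C_k_on_const[OF assms(1)]) simp_all
qed (use assms(2) in \<open>simp add: continuous_on_inverse\<close>)

text \<open>The density is a constant times the inverse square of a polynomial without zeros in the region.\<close>

lemma C_k_on_moebius_density: "C_k_on k (moebius_density F G) (region F G)"
proof -
  let ?r = "\<lambda>z. area (point F (fst z)) (point G (snd z))"
  note C_k = C_k_on_add[OF open_region] C_k_on_mult[OF open_region] C_k_on_const[OF open_region]
    C_k_on_linear[OF bounded_linear_fst open_region] C_k_on_linear[OF bounded_linear_snd open_region]
  have "C_k_on k ?r (region F G)"
    unfolding point_def area_simps by (intro C_k)
  then have "C_k_on k (\<lambda>z. inverse (?r z)) (region F G)"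
    by (intro C_k_on_inverse open_region) (simp_all add: region_def)
  then have "C_k_on k (\<lambda>z. (frame_area F * frame_area G) * (inverse (?r z) * inverse (?r z))) (region F G)"
    by (intro C_k)
  then show ?thesis
    by (simp add: moebius_density_def[abs_def] divide_inverse power2_eq_square)
qed

lemma moebius_form_invariant_form: "moebius_form invariant_form"
proof -
  have "bilinear (invariant_form c p)" "invariant_form c p u u = 0" for c p u
    unfolding bilinear_def invariant_form_def dx_wedge_dy_def
    by (auto intro!: linearI simp: algebra_simps)
  moreover have "C_k_on k (\<lambda>x. invariant_form c (chart_inv c x) u v) (chart_map c ` chart_dom c)"
    if "c \<in> FCF1_atlas" for c u v k
  proof -
    let ?F = "fst (frames_of c)" and ?G = "snd (frames_of c)"
    have c: "framed c ?F ?G" using that by (rule framed_frames_of)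
    have "C_k_on k (\<lambda>x. invariant_form c (chart_inv c x) u v) (region ?F ?G) \<longleftrightarrow>
        C_k_on k (\<lambda>x. moebius_density ?F ?G x * dx_wedge_dy u v) (region ?F ?G)"
      using c by (intro C_k_on_cong open_region) (simp add: invariant_form_def framed_inv[OF c]; simp add: framed_def)
    then show ?thesis
      unfolding framed_image[OF c]
      using C_k_on_mult[OF open_region C_k_on_moebius_density C_k_on_const[OF open_region]] by blast
  qed
  moreover have "form_invariant FCF1_atlas id invariant_form"
    by (rule form_invariant_invariant_form[OF acts_as_id])
  ultimately show ?thesis
    by (simp add: moebius_form_def top_form_def PGL2_action_invariant)
qed

section \<open>The topology of the surface\<close>

lemma FCF1_atlas_inj: "c \<in> FCF1_atlas \<Longrightarrow> inj_on (chart_map c) (chart_dom c)"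
  using FCF1_atlas_framed framed_inj by metis

lemma openin_FCF1:
  "openin (surface_topology FCF1_atlas) S \<longleftrightarrow>
    S \<subseteq> surface_points FCF1_atlas \<and> (\<forall>c\<in>FCF1_atlas. open (chart_map c ` (S \<inter> chart_dom c)))"
  by (rule openin_surface_topology) (rule FCF1_atlas_inj)

text \<open>Transition maps are continuous on open domains, so openness of a part of a chart domain can be
  checked in that chart alone.\<close>

lemma open_transition_image:
  assumes c: "framed c F G" and d: "framed d F' G'" and U: "U \<subseteq> chart_dom c" "open (chart_map c ` U)"
  shows "open (chart_map d ` (U \<inter> chart_dom d))"
proof -
  define W where "W = {z. area (point F' (fst z)) (snd F) \<noteq> 0 \<and> area (point G' (snd z)) (snd G) \<noteq> 0}
      \<inter> region F' G'"
  define f where "f z = (coordinate F (point F' (fst z)), coordinate G (point G' (snd z)))" for z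
  have "continuous_on UNIV (\<lambda>z. area (point F' (fst z)) (snd F))"
    "continuous_on UNIV (\<lambda>z. area (point G' (snd z)) (snd G))"
    unfolding point_def by (intro continuous_intros)+
  then have "open W"
    unfolding W_def
    by (intro open_Int open_region open_Collect_conj) (auto intro!: open_Collect_neq)
  moreover have "continuous_on W f"
    unfolding f_def coordinate_def by (intro continuous_intros) (auto simp: W_def point_def intro!: continuous_intros)
  ultimately have "open (W \<inter> f -` (chart_map c ` U))"
    using U(2) by (simp add: continuous_open_preimage)
  moreover have "chart_map d ` (U \<inter> chart_dom d) = W \<inter> f -` (chart_map c ` U)"
  proof -
    have *: "pair_at F' G' z \<in> chart_dom c \<longleftrightarrow> z \<in> W" "z \<in> W \<Longrightarrow> chart_map c (pair_at F' G' z) = f z"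
      if "z \<in> region F' G'" for z
      using that framed_mem_iff[OF c] framed_map[OF c] unfolding pair_at_def W_def f_def region_def by auto
    have "pair_at F' G' z \<in> U \<longleftrightarrow> z \<in> W \<and> f z \<in> chart_map c ` U" if z: "z \<in> region F' G'" for z
      using *[OF z] inj_on_image_mem_iff[OF framed_inj[OF c] _ U(1), of "pair_at F' G' z"] U(1)
      by (cases "z \<in> W") auto
    moreover have "chart_map d ` (U \<inter> chart_dom d) = {z \<in> region F' G'. pair_at F' G' z \<in> U}"
    proof -
      have dom: "chart_dom d = pair_at F' G' ` region F' G'"
        using d by (simp add: framed_def)
      have map: "chart_map d (pair_at F' G' z) = z" if "z \<in> region F' G'" for z
        using d that by (simp add: framed_def)
      have "U \<inter> chart_dom d = pair_at F' G' ` {z \<in> region F' G'. pair_at F' G' z \<in> U}"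
        unfolding dom by blast
      then show ?thesis by (simp add: image_image map)
    qed
    moreover have "W \<subseteq> region F' G'" by (simp add: W_def)
    ultimately show ?thesis by auto
  qed
  ultimately show ?thesis by simp
qed

lemma openin_single_chart:
  assumes "c \<in> FCF1_atlas"
  shows "openin (surface_topology {c}) U \<longleftrightarrow> U \<subseteq> chart_dom c \<and> open (chart_map c ` U)"
proof -
  have "openin (surface_topology {c}) U \<longleftrightarrow>
      U \<subseteq> surface_points {c} \<and> (\<forall>d\<in>{c}. open (chart_map d ` (U \<inter> chart_dom d)))"
    by (rule openin_surface_topology) (use assms FCF1_atlas_inj in auto)
  also have "\<dots> \<longleftrightarrow> U \<subseteq> chart_dom c \<and> open (chart_map c ` U)"
    by (auto simp: surface_points_def Int_absorb2)
  finally show ?thesis .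
qed

lemma openin_single_chart_iff:
  assumes "c \<in> FCF1_atlas"
  shows "openin (surface_topology {c}) U \<longleftrightarrow> U \<subseteq> chart_dom c \<and> openin (surface_topology FCF1_atlas) U"
proof -
  have "open (chart_map d ` (U \<inter> chart_dom d))"
    if "U \<subseteq> chart_dom c" "open (chart_map c ` U)" "d \<in> FCF1_atlas" for d
    using FCF1_atlas_framed open_transition_image assms that by metis
  moreover have "chart_dom c \<subseteq> surface_points FCF1_atlas"
    using assms by (auto simp: surface_points_def)
  ultimately show ?thesis
    unfolding openin_single_chart[OF assms] openin_FCF1 using assms by (auto simp: Int_absorb2)
qed

lemma openin_chart_dom:
  assumes "c \<in> FCF1_atlas"
  shows "openin (surface_topology FCF1_atlas) (chart_dom c)"
proof -
  obtain F G where c: "framed c F G" using FCF1_atlas_framed[OF assms] .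
  have "openin (surface_topology {c}) (chart_dom c)"
    using openin_single_chart[OF assms] open_region by (simp add: framed_image[OF c])
  then show ?thesis using openin_single_chart_iff[OF assms] by blast
qed

lemma chart_inv_chart_map: "c \<in> FCF1_atlas \<Longrightarrow> p \<in> chart_dom c \<Longrightarrow> chart_inv c (chart_map c p) = p"
  unfolding chart_inv_def using FCF1_atlas_inj by (rule inv_into_f_f)

section \<open>The measure transported from a chart\<close>

definition inverse_square_measure :: "(real \<times> real) measure" where
  "inverse_square_measure = density lborel (\<lambda>z. ennreal (1 / (fst z - snd z)\<^sup>2))"

lemma sets_inverse_square_measure [simp]: "sets inverse_square_measure = sets borel"
  "space inverse_square_measure = UNIV"
  by (simp_all add: inverse_square_measure_def)

lemma emeasure_inverse_square_measure:
  assumes "B \<in> sets borel"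
  shows "emeasure inverse_square_measure B = (\<integral>\<^sup>+z\<in>B. ennreal (1 / (fst z - snd z)\<^sup>2) \<partial>lborel)"
proof -
  have "(\<lambda>z::real \<times> real. 1 / (fst z - snd z)\<^sup>2) \<in> borel_measurable (borel \<Otimes>\<^sub>M borel)"
    by measurable
  then have "(\<lambda>z::real \<times> real. 1 / (fst z - snd z)\<^sup>2) \<in> borel_measurable borel"
    by (simp add: borel_prod)
  then show ?thesis
    unfolding inverse_square_measure_def using assms by (subst emeasure_density) auto
qed

definition FCF1_sigma :: "line_pair measure" where
  "FCF1_sigma = sigma (surface_points FCF1_atlas) {S. openin (surface_topology FCF1_atlas) S}"

definition chart_measure ::
  "(line_pair, real \<times> real) chart \<Rightarrow> line_pair measure"
  where "chart_measure c =
    distr (restrict_space inverse_square_measure (chart_map c ` chart_dom c)) FCF1_sigma (chart_inv c)"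

lemma opens_subset: "{S. openin (surface_topology FCF1_atlas) S} \<subseteq> Pow (surface_points FCF1_atlas)"
  by (auto simp: openin_FCF1)

lemma sets_FCF1_sigma:
  "sets FCF1_sigma = sigma_sets (surface_points FCF1_atlas) {S. openin (surface_topology FCF1_atlas) S}"
  "space FCF1_sigma = surface_points FCF1_atlas"
  unfolding FCF1_sigma_def using opens_subset by simp_all

lemma sets_chart_measure [simp]:
  "sets (chart_measure c) = sets FCF1_sigma" "space (chart_measure c) = surface_points FCF1_atlas"
  by (simp_all add: chart_measure_def sets_FCF1_sigma)

lemma chart_image_open:
  assumes "c \<in> FCF1_atlas"
  shows "open (chart_map c ` chart_dom c)"
  using FCF1_atlas_framed[OF assms] framed_image open_region by metis

lemma chart_inv_vimage:
  assumes "c \<in> FCF1_atlas"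
  shows "chart_inv c -` S \<inter> chart_map c ` chart_dom c = chart_map c ` (S \<inter> chart_dom c)"
  using chart_inv_chart_map[OF assms] by force

lemma chart_inv_measurable:
  assumes c: "c \<in> FCF1_atlas"
  shows "chart_inv c \<in> measurable (restrict_space inverse_square_measure (chart_map c ` chart_dom c)) FCF1_sigma"
  unfolding FCF1_sigma_def
proof (rule measurable_measure_of[OF opens_subset])
  show "chart_inv c \<in> space (restrict_space inverse_square_measure (chart_map c ` chart_dom c)) \<rightarrow>
      surface_points FCF1_atlas"
    using c chart_inv_chart_map[OF c] by (auto simp: surface_points_def space_restrict_space)
  fix S assume "S \<in> {S. openin (surface_topology FCF1_atlas) S}"
  then have "open (chart_map c ` (S \<inter> chart_dom c))"
    using c by (simp add: openin_FCF1)
  then show "chart_inv c -` S \<inter> space (restrict_space inverse_square_measure (chart_map c ` chart_dom c))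
      \<in> sets (restrict_space inverse_square_measure (chart_map c ` chart_dom c))"
    using chart_image_open[OF c]
    by (subst sets_restrict_space_iff) (auto simp: space_restrict_space chart_inv_vimage[OF c])
qed

lemma emeasure_chart_measure:
  assumes c: "c \<in> FCF1_atlas" and S: "S \<in> sets FCF1_sigma"
  shows "emeasure (chart_measure c) S = emeasure inverse_square_measure (chart_map c ` (S \<inter> chart_dom c))"
proof -
  have "emeasure (chart_measure c) S =
      emeasure (restrict_space inverse_square_measure (chart_map c ` chart_dom c)) (chart_map c ` (S \<inter> chart_dom c))"
    unfolding chart_measure_def using emeasure_distr[OF chart_inv_measurable[OF c] S]
    by (simp add: space_restrict_space chart_inv_vimage[OF c])
  also have "\<dots> = emeasure inverse_square_measure (chart_map c ` (S \<inter> chart_dom c))"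
    using chart_image_open[OF c] by (intro emeasure_restrict_space) auto
  finally show ?thesis .
qed

text \<open>Restricting the Borel sets of the surface to a chart domain gives the Borel sets of the chart, since
  the domain is open and carries the subspace topology (\<open>openin_single_chart_iff\<close>).\<close>

lemma sets_restrict_chart_measure:
  assumes c: "c \<in> FCF1_atlas"
  shows "sets (restrict_space (chart_measure d) (chart_dom c)) =
    sigma_sets (surface_points {c}) {S. openin (surface_topology {c}) S}"
proof -
  have o: "openin (surface_topology FCF1_atlas) (chart_dom c)" by (rule openin_chart_dom[OF c])
  then have sub: "chart_dom c \<subseteq> surface_points FCF1_atlas" by (simp add: openin_FCF1)
  have "sets (restrict_space (chart_measure d) (chart_dom c)) =
      sigma_sets (chart_dom c) ((\<inter>) (chart_dom c) ` {S. openin (surface_topology FCF1_atlas) S})"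
    unfolding sets_restrict_space sets_chart_measure sets_FCF1_sigma
    using o sub by (intro sigma_sets_Int) auto
  also have "(\<inter>) (chart_dom c) ` {S. openin (surface_topology FCF1_atlas) S} = {S. openin (surface_topology {c}) S}"
    unfolding openin_single_chart_iff[OF c] using o by (auto simp: image_iff)
  finally show ?thesis by (simp add: surface_points_def)
qed

lemma emeasure_restrict_chart_measure:
  assumes c: "c \<in> FCF1_atlas" and S: "openin (surface_topology {c}) S"
  shows "emeasure (restrict_space (chart_measure c) (chart_dom c)) S =
    emeasure inverse_square_measure (chart_map c ` S)"
proof -
  have S: "S \<subseteq> chart_dom c" "openin (surface_topology FCF1_atlas) S"
    using S openin_single_chart_iff[OF c] by auto
  have "chart_dom c \<in> sets FCF1_sigma" "S \<in> sets FCF1_sigma"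
    using openin_chart_dom[OF c] S(2) by (auto simp: sets_FCF1_sigma)
  then show ?thesis
    using S(1) sets.sets_into_space[of "chart_dom c" "FCF1_sigma"] emeasure_chart_measure[OF c, of S]
    by (subst emeasure_restrict_space) (auto simp: sets_FCF1_sigma Int_absorb2)
qed

section \<open>Density and orientation in charts\<close>

lemma area_point_point: "area (point F s) (point F t) = frame_area F * (t - s)"
  by (simp add: point_def frame_area_def area_commute[of "snd F"] algebra_simps)

lemma region_same: "frame_area F \<noteq> 0 \<Longrightarrow> region F F = {z. fst z \<noteq> snd z}"
  by (auto simp: region_def area_point_point)

lemma moebius_density_same:
  "frame_area F \<noteq> 0 \<Longrightarrow> moebius_density F F z = 1 / (fst z - snd z)\<^sup>2"
  by (simp add: moebius_density_def area_point_point power2_eq_square divide_simps) algebra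

lemma local_differential_id:
  assumes "framed c F G" "p \<in> chart_dom c"
  shows "local_differential c c id p = (\<lambda>w. w)"
proof -
  have "stretch (mat 1) F F t = 1" "stretch (mat 1) G G t = 1" for t
    using assms(1) by (simp_all add: stretch_def framed_def power2_eq_square)
  then show ?thesis
    using moebius_transition(1)[OF assms(1,1) acts_as_id assms(2)] assms(2) by simp
qed

text \<open>Two pairs of frames for one chart are related by the transition map of the chart to itself. Its
  differential is the identity, so both stretching factors are \<open>1\<close>.\<close>

lemma moebius_density_chart:
  assumes "framed c F G" "framed c F' G'" "p \<in> chart_dom c"
  shows "moebius_density F' G' (chart_map c p) = moebius_density F G (chart_map c p)"
proof -
  note transition = moebius_transition[OF assms(1,2) acts_as_id assms(3)]
  have "stretch (mat 1) F F' (fst (chart_map c p)) = 1" "stretch (mat 1) G G' (snd (chart_map c p)) = 1"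
    using transition(1) local_differential_id[OF assms(1,3)] assms(3)
    by (auto dest: fun_cong[of _ _ "(1, 1)"])
  then show ?thesis
    using transition(2) assms(3) by simp
qed

text \<open>The sign of the Jacobian of a transition map is the product of the signs of the four frame areas,
  as \<open>stretch\<close> shows. So these signs orient the whole surface at once.\<close>

definition frame_orientation ::
  "(line_pair, real \<times> real) chart \<Rightarrow> line_pair \<Rightarrow> real" where
  "frame_orientation c p = sgn (frame_area (fst (frames_of c)) * frame_area (snd (frames_of c)))"

lemma orientation_on_frame_orientation: "orientation_on FCF1_atlas C frame_orientation"
  unfolding orientation_on_def
proof (intro conjI ballI)
  fix c p assume c: "c \<in> FCF1_atlas"
  show "frame_orientation c p \<in> {-1, 1}"
    using framed_frames_of[OF c] by (auto simp: frame_orientation_def framed_def sgn_real_def)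
  show "continuous_on (chart_map c ` (chart_dom c \<inter> C)) (\<lambda>x. frame_orientation c (chart_inv c x))"
    by (simp add: frame_orientation_def)
  fix d assume d: "d \<in> FCF1_atlas" and p: "p \<in> chart_dom c \<inter> chart_dom d \<inter> C"
  have "p \<in> chart_dom c" "id p \<in> chart_dom d" using p by auto
  note tr = moebius_transition[OF framed_frames_of[OF c] framed_frames_of[OF d] acts_as_id this]
  show "frame_orientation c p = frame_orientation d p *
      sgn (dx_wedge_dy (local_differential c d id p (1, 0)) (local_differential c d id p (0, 1)))"
    using tr(3,4) framed_frames_of[OF d]
    by (simp add: tr(1) dx_wedge_dy_def frame_orientation_def stretch_def sgn_mult framed_def power2_eq_square field_simps)
qed

text \<open>If all pieces of a decomposition but one are null sets and the form is nonnegative for the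
  orientation, then the integral is the one over the remaining piece: the negative part vanishes.\<close>

lemma has_form_integral_if_null:
  fixes c :: "nat \<Rightarrow> ('m, real \<times> real) chart"
  assumes c: "\<And>i. c i \<in> A" "\<And>i. inj_on (chart_map (c i)) (chart_dom (c i))"
    and T: "\<And>i. T i \<subseteq> chart_dom (c i)" "\<And>i. chart_map (c i) ` T i \<in> sets borel"
      "disjoint_family T" "(\<Union>i. T i) = S"
    and nonneg: "\<And>i p. p \<in> T i \<Longrightarrow> 0 \<le> s (c i) p * w (c i) p (1, 0) (0, 1)"
    and null: "\<And>i. i \<noteq> 0 \<Longrightarrow> chart_map (c i) ` T i \<in> null_sets lborel"
  shows "has_form_integral A s w S (enn2ereal (\<integral>\<^sup>+x\<in>chart_map (c 0) ` T 0.
    (let p = chart_inv (c 0) x in ennreal (s (c 0) p * w (c 0) p (1, 0) (0, 1))) \<partial>lborel))"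
proof -
  define J where "J \<epsilon> i = (\<integral>\<^sup>+x\<in>chart_map (c i) ` T i. (let p = chart_inv (c i) x in
                 ennreal (\<epsilon> * (s (c i) p * w (c i) p (1, 0) (0, 1)))) \<partial>lborel)" for \<epsilon> :: real and i
  have "chart_inv (c i) (chart_map (c i) p) = p" if "p \<in> T i" for i p
    using that c(2) T(1) unfolding chart_inv_def by (meson inv_into_f_f subsetD)
  then have "J (-1) i = (\<integral>\<^sup>+(x::real \<times> real). 0 \<partial>lborel)" for i
    unfolding J_def using nonneg
    by (intro nn_integral_cong) (auto simp: Let_def indicator_def ennreal_neg)
  then have "J (-1) i = 0" for i
    by simp
  moreover have "J \<epsilon> i = 0" if "i \<noteq> 0" for \<epsilon> i
    unfolding J_def by (rule nn_integral_null_set[OF null[OF that]])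
  then have "(\<Sum>i. J \<epsilon> i) = J \<epsilon> 0" for \<epsilon>
    by (subst suminf_finite[of "{0}"]) auto
  ultimately have "\<not> ((\<Sum>i. J 1 i) = \<infinity> \<and> (\<Sum>i. J (-1) i) = \<infinity>)"
    and "enn2ereal (J 1 0) = enn2ereal (\<Sum>i. J 1 i) - enn2ereal (\<Sum>i. J (-1) i)"
    by (simp_all add: zero_ennreal.rep_eq)
  then have "has_form_integral A s w S (enn2ereal (J 1 0))"
    unfolding has_form_integral_def Let_def J_def using c(1) T by (intro exI conjI allI)
  then show ?thesis by (simp add: J_def)
qed

lemma e2ennreal_abs_enn2ereal [simp]: "e2ennreal \<bar>enn2ereal x\<bar> = x"
  by (metis abs_ereal_ge0 e2ennreal_enn2ereal enn2ereal_nonneg)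

section \<open>The measure of the invariant form\<close>

lemma null_sets_coordinate_axis:
  "{z::real \<times> real. fst z = 0} \<in> null_sets lborel" "{z::real \<times> real. snd z = 0} \<in> null_sets lborel"
proof -
  have "negligible {z::real \<times> real. (1, 0) \<bullet> z = 0}" "negligible {z::real \<times> real. (0, 1) \<bullet> z = 0}"
    by (intro negligible_hyperplane; simp add: zero_prod_def)+
  moreover have "closed {z::real \<times> real. (1, 0) \<bullet> z = 0}" "closed {z::real \<times> real. (0, 1) \<bullet> z = 0}"
    by (intro closed_hyperplane)+
  ultimately show "{z::real \<times> real. fst z = 0} \<in> null_sets lborel"
      "{z::real \<times> real. snd z = 0} \<in> null_sets lborel"
    by (auto simp: negligible_iff_null_sets null_sets_completion_iff inner_prod_def)
qed

lemma area_both_zero: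
  assumes "area u e = 0" "area v e = 0" "e \<noteq> 0"
  shows "area u v = 0"
proof -
  obtain k m where "u = k *\<^sub>R e" "v = m *\<^sub>R e"
    using assms area_eq_0_iff by blast
  then show ?thesis by simp
qed

text \<open>The frame \<open>(e, a / \<bar>a\<bar>)\<close> belongs to a line which the lines parallel to \<open>e\<close> do meet, and since \<open>e\<close> is its
  base point they meet it at coordinate \<open>0\<close>. The direction is normalised because coordinates on a line
  must be Euclidean.\<close>

lemma complementary_chart:
  assumes F: "frame_area F \<noteq> 0" "norm (snd F) = 1"
  obtains m \<eta> F' where "line_with_coordinate m \<eta>" "0 \<notin> m" "frame_area F' \<noteq> 0" "m = range (point F')"
    "\<And>t. \<eta> (point F' t) = t" "fst F' = snd F" "\<And>v. area v (snd F) = 0 \<Longrightarrow> v \<noteq> 0 \<Longrightarrow> area v (snd F') \<noteq> 0"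
proof -
  define F' where "F' = (snd F, (1 / norm (fst F)) *\<^sub>R fst F)"
  have a: "fst F \<noteq> 0" using F(1) by (auto simp: frame_area_def)
  have F': "frame_area F' \<noteq> 0"
    using a F(1) area_commute[of "fst F" "snd F"] by (simp add: F'_def frame_area_def)
  have "line_with_coordinate (range (point F')) (coordinate F')"
    unfolding line_with_coordinate_def
    by (rule exI[of _ "fst F'"], rule exI[of _ "snd F'"])
      (use a F' coordinate_point[OF F'] in \<open>simp add: F'_def point_def[abs_def]\<close>)
  moreover have "0 \<notin> range (point F')"
    using F' by (metis area_point area_simps(6) rangeE)
  moreover have "area v (snd F') \<noteq> 0" if v: "area v (snd F) = 0" "v \<noteq> 0" for v
  proof -
    have "snd F \<noteq> 0" using F(2) by auto
    then obtain k where "v = k *\<^sub>R snd F" using v area_eq_0_iff by blast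
    then show ?thesis
      using v(2) F' by (auto simp: F'_def frame_area_def)
  qed
  ultimately show ?thesis
    using that[of "range (point F')" "coordinate F'" F'] F' coordinate_point[OF F'] by (simp add: F'_def)
qed

text \<open>The pairs outside the chart of \<open>l\<close> have exactly one line parallel to \<open>l\<close>, as two such lines would
  coincide. Intersecting that line with the complementary line and the other one with \<open>l\<close> gives charts
  in which these pairs form a coordinate axis.\<close>

lemma chart_decomposition:
  assumes l: "line_with_coordinate l \<xi>" "0 \<notin> l"
  obtains c1 c2 P1 P2 where "c1 \<in> FCF1_atlas" "c2 \<in> FCF1_atlas"
    "P1 = {p \<in> chart_dom c1. snd (chart_map c1 p) = 0}" "P2 = {p \<in> chart_dom c2. fst (chart_map c2 p) = 0}"
    "FCF1 = chart_dom (FCF1_chart l \<xi>) \<union> P1 \<union> P2" "chart_dom (FCF1_chart l \<xi>) \<inter> P1 = {}"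
    "chart_dom (FCF1_chart l \<xi>) \<inter> P2 = {}" "P1 \<inter> P2 = {}"
proof -
  obtain F where F: "frame_area F \<noteq> 0" "l = range (point F)" "\<And>t. \<xi> (point F t) = t" "norm (snd F) = 1"
    using line_with_coordinate_frame[OF l] by blast
  obtain m \<eta> F' where m: "line_with_coordinate m \<eta>" "0 \<notin> m"
    and F': "frame_area F' \<noteq> 0" "m = range (point F')" "\<And>t. \<eta> (point F' t) = t"
    and eq: "fst F' = snd F" and nz: "\<And>v. area v (snd F) = 0 \<Longrightarrow> v \<noteq> 0 \<Longrightarrow> area v (snd F') \<noteq> 0"
    by (rule complementary_chart[OF F(1,4)]) (rule that)
  define c where "c = FCF1_chart l \<xi>"
  define c1 where "c1 = FCF1_product_chart (RP1_chart l \<xi>) (RP1_chart m \<eta>)"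
  define c2 where "c2 = FCF1_product_chart (RP1_chart m \<eta>) (RP1_chart l \<xi>)"
  have atlas: "c1 \<in> FCF1_atlas" "c2 \<in> FCF1_atlas"
    using l m unfolding FCF1_atlas_def RP1_atlas_def c1_def c2_def by blast+
  have c: "framed c F F" and c1: "framed c1 F F'" and c2: "framed c2 F' F"
    unfolding c_def FCF1_chart_def c1_def c2_def
    by (intro product_chart_framed F F')+
  define P1 P2 where P_def: "P1 = {p \<in> chart_dom c1. snd (chart_map c1 p) = 0}"
    "P2 = {p \<in> chart_dom c2. fst (chart_map c2 p) = 0}"
  have dom: "(span {u}, span {v}) \<in> chart_dom c \<longleftrightarrow> area u (snd F) \<noteq> 0 \<and> area v (snd F) \<noteq> 0"
    "(span {u}, span {v}) \<in> P1 \<longleftrightarrow> area v (snd F) = 0"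
    "(span {u}, span {v}) \<in> P2 \<longleftrightarrow> area u (snd F) = 0"
    if uv: "area u v \<noteq> 0" for u v
  proof -
    have nz': "u \<noteq> 0" "v \<noteq> 0" "snd F \<noteq> 0" using uv F(4) by auto
    have both: "area u (snd F) \<noteq> 0 \<or> area v (snd F) \<noteq> 0"
      using uv nz'(3) area_both_zero by blast
    have coord: "coordinate F' w = 0 \<longleftrightarrow> area w (snd F) = 0" if "area w (snd F') \<noteq> 0" for w
      using that area_commute[of w "snd F"] by (simp add: coordinate_def eq)
    show "(span {u}, span {v}) \<in> chart_dom c \<longleftrightarrow> area u (snd F) \<noteq> 0 \<and> area v (snd F) \<noteq> 0"
      by (rule framed_mem_iff[OF c uv])
    show "(span {u}, span {v}) \<in> P1 \<longleftrightarrow> area v (snd F) = 0"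
      using framed_mem_iff[OF c1 uv] framed_map[OF c1 uv] coord[of v] both nz[of v] nz' by (auto simp: P_def)
    show "(span {u}, span {v}) \<in> P2 \<longleftrightarrow> area u (snd F) = 0"
      using framed_mem_iff[OF c2 uv] framed_map[OF c2 uv] coord[of u] both nz[of u] nz' by (auto simp: P_def)
  qed
  have sub: "chart_dom c \<subseteq> FCF1" "P1 \<subseteq> FCF1" "P2 \<subseteq> FCF1"
    using framed_dom_subset[OF c] framed_dom_subset[OF c1] framed_dom_subset[OF c2] by (auto simp: P_def)
  have both: "area u (snd F) \<noteq> 0 \<or> area v (snd F) \<noteq> 0" if uv: "area u v \<noteq> 0" for u v
  proof -
    have "snd F \<noteq> 0" using F(4) by auto
    then show ?thesis using uv area_both_zero by blast
  qed
  have "(p \<in> chart_dom c \<longleftrightarrow> p \<notin> P1 \<and> p \<notin> P2) \<and> \<not> (p \<in> P1 \<and> p \<in> P2)" if p: "p \<in> FCF1" for p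
  proof -
    obtain u v where "p = (span {u}, span {v})" "area u v \<noteq> 0" using p unfolding FCF1_eq by blast
    then show ?thesis using dom[of u v] both[of u v] by auto
  qed
  then have "FCF1 = chart_dom c \<union> P1 \<union> P2" "chart_dom c \<inter> P1 = {}" "chart_dom c \<inter> P2 = {}" "P1 \<inter> P2 = {}"
    using sub by blast+
  with atlas P_def show ?thesis by (rule that[folded c_def])
qed

lemma FCF1_chart_in_atlas:
  assumes "line_with_coordinate l \<xi>" "0 \<notin> l"
  shows "FCF1_chart l \<xi> \<in> FCF1_atlas"
proof -
  have "RP1_chart l \<xi> \<in> RP1_atlas"
    unfolding RP1_atlas_def using assms by blast
  then show ?thesis
    unfolding FCF1_atlas_def FCF1_chart_def by blast
qed

lemma surface_points_FCF1: "surface_points FCF1_atlas = FCF1"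
proof
  show "surface_points FCF1_atlas \<subseteq> FCF1"
    unfolding surface_points_def using FCF1_atlas_framed framed_dom_subset by (metis UN_least)
  define F :: frame where "F = (axis 1 1, axis 2 1)"
  have F: "frame_area F \<noteq> 0" "norm (snd F) = 1"
    by (simp add: F_def frame_area_def area_def axis_def) (simp add: F_def norm_axis_1)
  obtain l \<xi> where l: "line_with_coordinate l \<xi>" "0 \<notin> l"
    by (rule complementary_chart[OF F]) (rule that)
  obtain c1 c2 P1 P2 where "c1 \<in> FCF1_atlas" "c2 \<in> FCF1_atlas"
    "P1 = {p \<in> chart_dom c1. snd (chart_map c1 p) = 0}" "P2 = {p \<in> chart_dom c2. fst (chart_map c2 p) = 0}"
    "FCF1 = chart_dom (FCF1_chart l \<xi>) \<union> P1 \<union> P2"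
    by (rule chart_decomposition[OF l]) (rule that)
  moreover have "FCF1_chart l \<xi> \<in> FCF1_atlas"
    by (rule FCF1_chart_in_atlas[OF l])
  ultimately show "FCF1 \<subseteq> surface_points FCF1_atlas"
    unfolding surface_points_def by blast
qed

lemma omega_chart_inv:
  assumes "c \<in> FCF1_atlas" "x \<in> chart_map c ` chart_dom c"
  shows "omega c (chart_inv c x) (1, 0) (0, 1) = 1 / (fst x - snd x)\<^sup>2"
  using assms by (auto simp: omega_def chart_inv_chart_map dx_wedge_dy_def split_beta)

lemma form_measure_invariant_form:
  assumes l: "line_with_coordinate l \<xi>" "0 \<notin> l"
  defines "c \<equiv> FCF1_chart l \<xi>"
  shows "is_form_measure FCF1_atlas invariant_form (chart_measure c)"
  unfolding is_form_measure_def
proof (intro conjI ballI)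
  show "space (chart_measure c) = surface_points FCF1_atlas" by simp
  show "sets (chart_measure c) = sigma_sets (surface_points FCF1_atlas) {S. openin (surface_topology FCF1_atlas) S}"
    by (simp add: sets_FCF1_sigma)
  obtain F where F: "frame_area F \<noteq> 0" "l = range (point F)" "\<And>t. \<xi> (point F t) = t"
    using line_with_coordinate_frame[OF l] by blast
  have c: "c \<in> FCF1_atlas" "framed c F F"
    unfolding c_def by (rule FCF1_chart_in_atlas[OF l])
      (unfold FCF1_chart_def, rule product_chart_framed[OF F F])
  obtain c1 c2 P1 P2 where c12: "c1 \<in> FCF1_atlas" "c2 \<in> FCF1_atlas"
    and P: "P1 = {p \<in> chart_dom c1. snd (chart_map c1 p) = 0}" "P2 = {p \<in> chart_dom c2. fst (chart_map c2 p) = 0}"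
    and cover: "FCF1 = chart_dom c \<union> P1 \<union> P2" "chart_dom c \<inter> P1 = {}" "chart_dom c \<inter> P2 = {}" "P1 \<inter> P2 = {}"
    using chart_decomposition[OF l, folded c_def] .
  fix C
  \<comment> \<open>For this orientation the form is its own absolute value.\<close>
  have oriented: "frame_orientation d p * invariant_form d p (1, 0) (0, 1) =
      \<bar>moebius_density (fst (frames_of d)) (snd (frames_of d)) (chart_map d p)\<bar>" for d p
  proof -
    have "sgn k * k = \<bar>k\<bar>" for k :: real
      by (simp add: abs_sgn mult.commute)
    then show ?thesis
      by (simp add: frame_orientation_def invariant_form_def dx_wedge_dy_def moebius_density_def)
  qed
  have "\<exists>r. has_form_integral FCF1_atlas frame_orientation invariant_form S r \<and>
      emeasure (chart_measure c) S = e2ennreal \<bar>r\<bar>"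
    if S: "openin (surface_topology FCF1_atlas) S" for S
  proof -
    define d where "d i = (if i = 1 then c1 else if i = 2 then c2 else c)" for i :: nat
    define T where "T i = (if i = 0 then S \<inter> chart_dom c
      else if i = 1 then S \<inter> P1
      else if i = 2 then S \<inter> P2 else {})" for i :: nat
    have op: "chart_map e ` (S \<inter> chart_dom e) \<in> sets borel" if "e \<in> FCF1_atlas" for e
      using S that by (simp add: openin_FCF1)
    have im: "chart_map c1 ` (S \<inter> P1) =
          chart_map c1 ` (S \<inter> chart_dom c1) \<inter> {z. snd z = 0}"
        "chart_map c2 ` (S \<inter> P2) =
          chart_map c2 ` (S \<inter> chart_dom c2) \<inter> {z. fst z = 0}"
      by (auto simp: P)
    have null: "chart_map (d i) ` T i \<in> null_sets lborel" if "i \<noteq> 0" for i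
    proof -
      have "chart_map c1 ` (S \<inter> P1) \<in> null_sets lborel"
        "chart_map c2 ` (S \<inter> P2) \<in> null_sets lborel"
        unfolding im
        using null_sets_coordinate_axis op[OF c12(1)] op[OF c12(2)] by (auto intro: null_set_Int1 null_set_Int2)
      then show ?thesis
        using that by (simp add: T_def d_def)
    qed
    have "has_form_integral FCF1_atlas frame_orientation invariant_form S
      (enn2ereal (\<integral>\<^sup>+x\<in>chart_map (d 0) ` T 0. (let p = chart_inv (d 0) x in
        ennreal (frame_orientation (d 0) p * invariant_form (d 0) p (1, 0) (0, 1))) \<partial>lborel))"
    proof (rule has_form_integral_if_null)
      show d: "d i \<in> FCF1_atlas" for i using c c12 by (simp add: d_def)
      then show "inj_on (chart_map (d i)) (chart_dom (d i))" for i by (rule FCF1_atlas_inj)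
      show "T i \<subseteq> chart_dom (d i)" for i by (auto simp: T_def d_def P)
      show "chart_map (d i) ` T i \<in> sets borel" for i
        using null[of i] op[OF c(1)] by (cases "i = 0") (auto simp: T_def d_def null_sets_def)
      show "disjoint_family T"
        using cover(2-4) by (auto simp: disjoint_family_on_def T_def)
      have "S \<subseteq> FCF1" using S by (simp add: openin_FCF1 surface_points_FCF1)
      then have "S = T 0 \<union> T 1 \<union> T 2"
        using cover(1) by (auto simp: T_def)
      moreover have "T i \<subseteq> S" for i by (auto simp: T_def)
      ultimately show "(\<Union>i. T i) = S" by blast
      show "0 \<le> frame_orientation (d i) p * invariant_form (d i) p (1, 0) (0, 1)" for i p
        by (simp add: oriented)
    qed (rule null)
    moreover have "(\<integral>\<^sup>+x\<in>chart_map (d 0) ` T 0. (let p = chart_inv (d 0) x in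
        ennreal (frame_orientation (d 0) p * invariant_form (d 0) p (1, 0) (0, 1))) \<partial>lborel) =
      emeasure (chart_measure c) S"
    proof -
      have "S \<in> sets FCF1_sigma" using S by (auto simp: sets_FCF1_sigma)
      then have "emeasure (chart_measure c) S =
          (\<integral>\<^sup>+z\<in>chart_map c ` (S \<inter> chart_dom c). ennreal (1 / (fst z - snd z)\<^sup>2) \<partial>lborel)"
        by (simp add: emeasure_chart_measure[OF c(1)] emeasure_inverse_square_measure op[OF c(1)])
      moreover have "\<bar>moebius_density (fst (frames_of c)) (snd (frames_of c)) (chart_map c p)\<bar> =
          1 / (fst (chart_map c p) - snd (chart_map c p))\<^sup>2" if "p \<in> chart_dom c" for p
        using moebius_density_chart[OF c(2) framed_frames_of[OF c(1)] that] c(2)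
        by (simp add: moebius_density_same framed_def)
      then have "frame_orientation c (chart_inv c x) * invariant_form c (chart_inv c x) (1, 0) (0, 1) =
          1 / (fst x - snd x)\<^sup>2" if "x \<in> chart_map c ` (S \<inter> chart_dom c)" for x
        using that by (auto simp: oriented chart_inv_chart_map[OF c(1)])
      ultimately show ?thesis
        by (auto simp: T_def d_def Let_def indicator_def intro!: nn_integral_cong)
    qed
    ultimately show ?thesis by force
  qed
  then show "\<exists>s. orientation_on FCF1_atlas C s \<and> (\<forall>S. openin (surface_topology FCF1_atlas) S \<and> S \<subseteq> C \<longrightarrow>
      (\<exists>r. has_form_integral FCF1_atlas s invariant_form S r \<and> emeasure (chart_measure c) S = e2ennreal \<bar>r\<bar>))"
    using orientation_on_frame_orientation by blast
qed

section \<open>Measures of the form in a single chart\<close>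

lemma topspace_single_chart: "c \<in> FCF1_atlas \<Longrightarrow> topspace (surface_topology {c}) = chart_dom c"
  using openin_single_chart[of c] chart_image_open[of c]
  by (metis openin_subset openin_topspace order_refl subset_antisym)

lemma connectedin_chart_inv:
  assumes c: "c \<in> FCF1_atlas" and B: "connected B" "B \<subseteq> chart_map c ` chart_dom c"
  shows "connectedin (surface_topology {c}) (chart_inv c ` B)"
proof (rule connectedin_continuous_map_image)
  show "connectedin (top_of_set (chart_map c ` chart_dom c)) B"
    using B by (simp add: connectedin_subtopology)
  show "continuous_map (top_of_set (chart_map c ` chart_dom c)) (surface_topology {c}) (chart_inv c)"
    unfolding continuous_map_def topspace_single_chart[OF c]
  proof (intro conjI allI impI)
    show "chart_inv c \<in> topspace (top_of_set (chart_map c ` chart_dom c)) \<rightarrow> chart_dom c"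
      by (auto simp: chart_inv_chart_map[OF c])
    fix U assume "openin (surface_topology {c}) U"
    then have U: "U \<subseteq> chart_dom c" "open (chart_map c ` U)"
      by (simp_all add: openin_single_chart[OF c])
    have "{x \<in> chart_map c ` chart_dom c. chart_inv c x \<in> U} = chart_map c ` U"
      using U(1) by (auto simp: chart_inv_chart_map[OF c])
    then show "openin (top_of_set (chart_map c ` chart_dom c))
        {x \<in> topspace (top_of_set (chart_map c ` chart_dom c)). chart_inv c x \<in> U}"
      using U by (simp add: open_subset image_mono)
  qed
qed

text \<open>The constant \<open>1\<close> is an orientation, since the only transition map of a one-chart atlas is the
  identity.\<close>

lemma form_measure_omega:
  assumes c: "c \<in> FCF1_atlas"
  shows "is_form_measure {c} omega (restrict_space (chart_measure c) (chart_dom c))"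
  unfolding is_form_measure_def
proof (intro conjI ballI)
  let ?s = "\<lambda>(_ :: (line_pair, real \<times> real) chart) (_ :: line_pair). 1 :: real"
  show "space (restrict_space (chart_measure c) (chart_dom c)) = surface_points {c}"
    using c by (auto simp: space_restrict_space surface_points_def)
  show "sets (restrict_space (chart_measure c) (chart_dom c)) =
      sigma_sets (surface_points {c}) {S. openin (surface_topology {c}) S}"
    by (rule sets_restrict_chart_measure[OF c])
  fix C
  obtain F G where F: "framed c F G" using FCF1_atlas_framed[OF c] .
  have "orientation_on {c} C ?s"
    by (auto simp: orientation_on_def local_differential_id[OF F] dx_wedge_dy_def)
  moreover have "\<exists>r. has_form_integral {c} ?s omega S r \<and>
      emeasure (restrict_space (chart_measure c) (chart_dom c)) S = e2ennreal \<bar>r\<bar>"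
    if S: "openin (surface_topology {c}) S" for S
  proof -
    have S': "S \<subseteq> chart_dom c" "open (chart_map c ` S)"
      using S by (simp_all add: openin_single_chart[OF c])
    define T where "T i = (if i = 0 then S else {})" for i :: nat
    have "has_form_integral {c} ?s omega S (enn2ereal (\<integral>\<^sup>+x\<in>chart_map c ` T 0.
        (let p = chart_inv c x in ennreal (?s c p * omega c p (1, 0) (0, 1))) \<partial>lborel))"
      by (rule has_form_integral_if_null)
        (use S' FCF1_atlas_inj[OF c] in \<open>auto simp: T_def disjoint_family_on_def omega_def dx_wedge_dy_def split_beta split: if_splits\<close>)
    moreover have "(\<integral>\<^sup>+x\<in>chart_map c ` T 0.
        (let p = chart_inv c x in ennreal (?s c p * omega c p (1, 0) (0, 1))) \<partial>lborel) =
      emeasure (restrict_space (chart_measure c) (chart_dom c)) S"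
    proof -
      have "omega c (chart_inv c x) (1, 0) (0, 1) = 1 / (fst x - snd x)\<^sup>2" if "x \<in> chart_map c ` S" for x
        using that S'(1) omega_chart_inv[OF c] by blast
      then show ?thesis
        using S'(2) by (auto simp: emeasure_restrict_chart_measure[OF c S] emeasure_inverse_square_measure T_def Let_def
          indicator_def intro!: nn_integral_cong)
    qed
    ultimately show ?thesis by force
  qed
  ultimately show "\<exists>s. orientation_on {c} C s \<and> (\<forall>S. openin (surface_topology {c}) S \<and> S \<subseteq> C \<longrightarrow>
      (\<exists>r. has_form_integral {c} s omega S r \<and>
        emeasure (restrict_space (chart_measure c) (chart_dom c)) S = e2ennreal \<bar>r\<bar>))"
    by blast
qed

text \<open>If the orientation is constant on \<open>U\<close>, then only the positive or only the negative part of the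
  integral survives. The integral over any decomposition of \<open>U\<close> within the chart is then the measure of the
  image of \<open>U\<close> up to sign, by countable additivity.\<close>

lemma form_integral_omega:
  assumes c: "c \<in> FCF1_atlas" and U: "U \<subseteq> chart_dom c"
    and \<kappa>: "\<kappa> \<in> {-1, 1}" "\<And>p. p \<in> U \<Longrightarrow> s c p = \<kappa>"
    and r: "has_form_integral {c} s omega U r"
  shows "e2ennreal \<bar>r\<bar> = emeasure inverse_square_measure (chart_map c ` U)"
proof -
  let ?m = "emeasure inverse_square_measure (chart_map c ` U)"
  define J where "J d T \<epsilon> = (\<Sum>i. \<integral>\<^sup>+x\<in>chart_map (d i) ` T i. (let p = chart_inv (d i) x in
                 ennreal (\<epsilon> * (s (d i) p * omega (d i) p (1, 0) (0, 1)))) \<partial>lborel)"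
    for d :: "nat \<Rightarrow> (line_pair, real \<times> real) chart"
      and T :: "nat \<Rightarrow> line_pair set" and \<epsilon> :: real
  have "\<exists>d T. (\<forall>i. d i \<in> {c} \<and> T i \<subseteq> chart_dom (d i) \<and> chart_map (d i) ` T i \<in> sets borel) \<and>
      disjoint_family T \<and> (\<Union>i. T i) = U \<and>
      (\<not> (J d T 1 = \<infinity> \<and> J d T (-1) = \<infinity>) \<and> r = enn2ereal (J d T 1) - enn2ereal (J d T (-1)))"
    using r unfolding has_form_integral_def Let_def J_def .
  then obtain d T where dT: "\<forall>i. d i \<in> {c} \<and> T i \<subseteq> chart_dom (d i) \<and> chart_map (d i) ` T i \<in> sets borel"
      "disjoint_family T" "(\<Union>i. T i) = U" and rJ: "r = enn2ereal (J d T 1) - enn2ereal (J d T (-1))"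
    by auto
  then have d: "d i = c" and T: "T i \<subseteq> chart_dom c" "chart_map c ` T i \<in> sets borel"
      "disjoint_family T" "(\<Union>i. T i) = U" for i
    by (metis singletonD)+
  have "disjoint_family (\<lambda>i. chart_map c ` T i)"
    using T(1,3) FCF1_atlas_inj[OF c] unfolding disjoint_family_on_def
    by (metis image_empty inj_on_image_Int UNIV_I)
  then have "(\<Sum>i. emeasure inverse_square_measure (chart_map c ` T i)) =
      emeasure inverse_square_measure (\<Union>i. chart_map c ` T i)"
    by (intro suminf_emeasure) (use T(2) in auto)
  also have "(\<Union>i. chart_map c ` T i) = chart_map c ` U"
    using T(4) by blast
  finally have sum: "(\<Sum>i. emeasure inverse_square_measure (chart_map c ` T i)) = ?m" .
  have "\<epsilon> * (s c (chart_inv c x) * omega c (chart_inv c x) (1, 0) (0, 1)) =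
      \<epsilon> * \<kappa> * (1 / (fst x - snd x)\<^sup>2)" if "x \<in> chart_map c ` T i" for x i \<epsilon>
  proof -
    have "chart_inv c x \<in> U" "x \<in> chart_map c ` chart_dom c"
      using that T(1,4) chart_inv_chart_map[OF c] by fastforce+
    then show ?thesis using \<kappa>(2) omega_chart_inv[OF c] by simp
  qed
  then have "(\<integral>\<^sup>+x\<in>chart_map c ` T i. (let p = chart_inv c x in
        ennreal (\<epsilon> * (s c p * omega c p (1, 0) (0, 1)))) \<partial>lborel) =
      (\<integral>\<^sup>+x\<in>chart_map c ` T i. ennreal (\<epsilon> * \<kappa> * (1 / (fst x - snd x)\<^sup>2)) \<partial>lborel)" for \<epsilon> i
    by (intro nn_integral_cong) (simp add: Let_def indicator_def)
  then have J: "J d T \<epsilon> = (if \<epsilon> * \<kappa> = 1 then ?m else 0)" if "\<epsilon> * \<kappa> \<in> {-1, 1}" for \<epsilon>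
    unfolding sum[symmetric] using that T(2) by (auto simp: J_def d emeasure_inverse_square_measure ennreal_neg)
  show ?thesis
    using \<kappa>(1) by (auto simp: rJ J zero_ennreal.rep_eq)
qed

lemma inverse_square_measure_box_finite:
  assumes "cbox a b \<subseteq> {z. fst z \<noteq> snd z}"
  shows "emeasure inverse_square_measure (box a b) \<noteq> \<infinity>"
proof -
  have "continuous_on (cbox a b) (\<lambda>z. 1 / (fst z - snd z)\<^sup>2)"
    using assms by (intro continuous_intros) auto
  then have "bounded ((\<lambda>z. 1 / (fst z - snd z)\<^sup>2) ` cbox a b)"
    using compact_continuous_image compact_imp_bounded compact_cbox by blast
  then obtain K where "\<forall>y\<in>(\<lambda>z. 1 / (fst z - snd z)\<^sup>2) ` cbox a b. norm y \<le> K"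
    unfolding bounded_iff by blast
  then have K: "1 / (fst z - snd z)\<^sup>2 \<le> K" if "z \<in> cbox a b" for z
    using that by simp
  have "emeasure inverse_square_measure (box a b) \<le> (\<integral>\<^sup>+z. ennreal K * indicator (cbox a b) z \<partial>lborel)"
    unfolding emeasure_inverse_square_measure[OF borel_open[OF open_box]]
    using K box_subset_cbox[of a b] by (intro nn_integral_mono) (auto simp: indicator_def ennreal_leI)
  also have "\<dots> = ennreal K * emeasure lborel (cbox a b)"
    by (simp add: nn_integral_cmult_indicator)
  also have "\<dots> < \<infinity>"
    using emeasure_lborel_cbox_finite[of a b] by (simp add: ennreal_mult_less_top)
  finally show ?thesis by simp
qed

text \<open>Requiring the closed box to lie in the image of the chart makes the measure of the open box
  finite.\<close>

definition chart_boxes ::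
  "(line_pair, real \<times> real) chart \<Rightarrow> line_pair set set" where
  "chart_boxes c = {U. U \<subseteq> chart_dom c \<and> (\<exists>a b. chart_map c ` U = box a b \<and> cbox a b \<subseteq> chart_map c ` chart_dom c)}"

text \<open>Every point of an open set has a box whose closure stays in the set; by the Lindeloef property
  countably many of them suffice.\<close>

lemma chart_boxes_cover:
  assumes c: "c \<in> FCF1_atlas" and U: "openin (surface_topology {c}) U"
  obtains \<U> where "countable \<U>" "\<U> \<subseteq> chart_boxes c" "\<Union>\<U> = U"
proof -
  have U: "U \<subseteq> chart_dom c" "open (chart_map c ` U)"
    using U by (simp_all add: openin_single_chart[OF c])
  define B where "B = {box a b | a b. cbox a b \<subseteq> chart_map c ` U}"
  have "\<Union>B = chart_map c ` U"
  proof
    show "\<Union>B \<subseteq> chart_map c ` U" unfolding B_def using box_subset_cbox by blast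
    show "chart_map c ` U \<subseteq> \<Union>B"
    proof
      fix x assume "x \<in> chart_map c ` U"
      then obtain a b where "cbox a b \<subseteq> chart_map c ` U" "x \<in> box a b"
        using open_contains_cbox[OF U(2)] by metis
      then show "x \<in> \<Union>B" unfolding B_def by blast
    qed
  qed
  moreover obtain B' where B': "B' \<subseteq> B" "countable B'" "\<Union>B' = \<Union>B"
    by (rule Lindelof[of B]) (auto simp: B_def)
  ultimately have un: "\<Union>B' = chart_map c ` U" by simp
  have im: "chart_map c ` chart_inv c ` X = X" "chart_inv c ` X \<subseteq> U" if "X \<subseteq> chart_map c ` U" for X
  proof -
    have "chart_map c (chart_inv c x) = x \<and> chart_inv c x \<in> U" if "x \<in> X" for x
      using that \<open>X \<subseteq> _\<close> U(1) chart_inv_chart_map[OF c] by force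
    then show "chart_map c ` chart_inv c ` X = X" "chart_inv c ` X \<subseteq> U"
      by (force simp: image_image)+
  qed
  show ?thesis
  proof
    show "countable ((`) (chart_inv c) ` B')" using B'(2) by simp
    show "(`) (chart_inv c) ` B' \<subseteq> chart_boxes c"
    proof
      fix V assume "V \<in> (`) (chart_inv c) ` B'"
      then obtain a b where V: "V = chart_inv c ` box a b" and ab: "cbox a b \<subseteq> chart_map c ` U"
        using B'(1) by (auto simp: B_def)
      have "box a b \<subseteq> chart_map c ` U" using ab box_subset_cbox by blast
      then have V': "chart_map c ` V = box a b" "V \<subseteq> chart_dom c"
        using im[of "box a b"] U(1) unfolding V by auto
      have "cbox a b \<subseteq> chart_map c ` chart_dom c"
        using ab U(1) by (meson image_mono order_trans)
      then have "\<exists>a b. chart_map c ` V = box a b \<and> cbox a b \<subseteq> chart_map c ` chart_dom c"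
        using V'(1) by metis
      then show "V \<in> chart_boxes c"
        unfolding chart_boxes_def mem_Collect_eq by (rule conjI[OF V'(2)])
    qed
    have "\<Union> ((`) (chart_inv c) ` B') = chart_inv c ` chart_map c ` U"
      unfolding un[symmetric] by blast
    also have "\<dots> = U"
      using U(1) chart_inv_chart_map[OF c] by (force simp: image_image)
    finally show "\<Union> ((`) (chart_inv c) ` B') = U" .
  qed
qed

lemma chart_boxes_open:
  assumes c: "c \<in> FCF1_atlas" and U: "U \<in> chart_boxes c"
  shows "openin (surface_topology {c}) U"
  using U openin_single_chart[OF c] by (auto simp: chart_boxes_def)

lemma Int_stable_chart_boxes:
  assumes "c \<in> FCF1_atlas"
  shows "Int_stable (chart_boxes c)"
proof (rule Int_stableI)
  fix U V assume U: "U \<in> chart_boxes c" and V: "V \<in> chart_boxes c"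
  obtain a b where ab: "U \<subseteq> chart_dom c" "chart_map c ` U = box a b" "cbox a b \<subseteq> chart_map c ` chart_dom c"
    using U unfolding chart_boxes_def by blast
  obtain a' b' where ab': "V \<subseteq> chart_dom c" "chart_map c ` V = box a' b'"
    using V unfolding chart_boxes_def by blast
  have "chart_map c ` (U \<inter> V) = box a b \<inter> box a' b'"
    using inj_on_image_Int[OF FCF1_atlas_inj[OF assms] ab(1) ab'(1)] ab(2) ab'(2) by simp
  moreover have "cbox a b \<inter> cbox a' b' \<subseteq> chart_map c ` chart_dom c" using ab(3) by blast
  ultimately show "U \<inter> V \<in> chart_boxes c"
    using ab(1) unfolding chart_boxes_def box_Int_box Int_interval by blast
qed

lemma form_measure_omega_unique:
  assumes c: "c \<in> FCF1_atlas" "framed c F F" and N: "is_form_measure {c} omega N"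
  shows "N = restrict_space (chart_measure c) (chart_dom c)"
proof -
  have dom: "openin (surface_topology {c}) (chart_dom c)"
    using openin_single_chart[OF c(1)] chart_image_open[OF c(1)] by simp
  obtain \<U> where \<U>: "countable \<U>" "\<U> \<subseteq> chart_boxes c" "\<Union>\<U> = chart_dom c"
    using chart_boxes_cover[OF c(1) dom] .
  have sigma: "sigma_sets (surface_points {c}) {S. openin (surface_topology {c}) S} =
      sigma_sets (chart_dom c) (chart_boxes c)"
  proof -
    have "S \<in> sigma_sets (chart_dom c) (chart_boxes c)" if oS: "openin (surface_topology {c}) S" for S
    proof -
      obtain \<V> where "countable \<V>" "\<V> \<subseteq> chart_boxes c" "\<Union>\<V> = S"
        using chart_boxes_cover[OF c(1) oS] .
      then show ?thesis
        using sigma_sets_UNION[of \<V> "chart_dom c" "chart_boxes c"] by (auto intro: sigma_sets.Basic)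
    qed
    moreover have "surface_points {c} = chart_dom c" by (simp add: surface_points_def)
    ultimately show ?thesis
      using chart_boxes_open[OF c(1)] by (auto intro!: sigma_sets_eqI intro: sigma_sets.Basic)
  qed
  show ?thesis
  proof (rule measure_eqI_generator_eq_countable[where E = "chart_boxes c" and \<Omega> = "chart_dom c" and A = \<U>])
    show "Int_stable (chart_boxes c)" by (rule Int_stable_chart_boxes[OF c(1)])
    show "chart_boxes c \<subseteq> Pow (chart_dom c)" by (auto simp: chart_boxes_def)
    show "sets N = sigma_sets (chart_dom c) (chart_boxes c)"
      using N sigma by (simp add: is_form_measure_def)
    show "sets (restrict_space (chart_measure c) (chart_dom c)) = sigma_sets (chart_dom c) (chart_boxes c)"
      using sigma by (simp add: sets_restrict_chart_measure[OF c(1)])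
    have eq: "emeasure N U = emeasure inverse_square_measure (chart_map c ` U)" if U: "U \<in> chart_boxes c" for U
    proof (cases "U = {}")
      case False
      have oU: "openin (surface_topology {c}) U" by (rule chart_boxes_open[OF c(1) U])
      obtain a b where ab: "U \<subseteq> chart_dom c" "chart_map c ` U = box a b"
        using U unfolding chart_boxes_def by blast
      have U_eq: "chart_inv c ` box a b = U"
        unfolding ab(2)[symmetric] using ab(1) chart_inv_chart_map[OF c(1)] by (force simp: image_image)
      \<comment> \<open>The orientation is only known to be locally constant on \<open>C\<close>; connectedness of the box makes it
        constant on \<open>U\<close>.\<close>
      have "connected (box a b)" by (simp add: convex_connected)
      then have "connectedin (surface_topology {c}) U"
        using connectedin_chart_inv[OF c(1), of "box a b"] U_eq ab by (metis image_mono)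
      moreover have "surface_topology {c} \<noteq> trivial_topology"
        using False oU openin_subset by fastforce
      ultimately obtain C where C: "C \<in> connected_components_of (surface_topology {c})" "U \<subseteq> C"
        using exists_connected_component_of_superset by metis
      obtain s r where s: "orientation_on {c} C s" and r: "has_form_integral {c} s omega U r"
          "emeasure N U = e2ennreal \<bar>r\<bar>"
        using N C oU unfolding is_form_measure_def by metis
      have "continuous_on (chart_map c ` (chart_dom c \<inter> C)) (\<lambda>x. s c (chart_inv c x))"
        using s by (simp add: orientation_on_def)
      then have "continuous_on (box a b) (\<lambda>x. s c (chart_inv c x))"
        by (rule continuous_on_subset) (use ab C(2) in blast)
      moreover have val: "s c p \<in> {-1, 1}" if "p \<in> U" for p
        using s ab(1) C(2) that unfolding orientation_on_def by blast
      then have "(\<lambda>x. s c (chart_inv c x)) ` box a b \<subseteq> {-1, 1}"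
        using U_eq by blast
      then have "finite ((\<lambda>x. s c (chart_inv c x)) ` box a b)"
        by (rule finite_subset) simp
      ultimately have "(\<lambda>x. s c (chart_inv c x)) constant_on box a b"
        using \<open>connected (box a b)\<close> continuous_finite_range_constant by blast
      then obtain \<kappa> where "\<And>p. p \<in> U \<Longrightarrow> s c p = \<kappa>"
        using U_eq unfolding constant_on_def by (metis imageE)
      moreover from this val False have "\<kappa> \<in> {-1, 1}" by blast
      ultimately show ?thesis
        using form_integral_omega[OF c(1) ab(1) _ _ r(1)] r(2) by simp
    qed simp
    show "emeasure N U = emeasure (restrict_space (chart_measure c) (chart_dom c)) U" if "U \<in> chart_boxes c" for U
      using eq[OF that] emeasure_restrict_chart_measure[OF c(1) chart_boxes_open[OF c(1) that]] by simp
    have image: "chart_map c ` chart_dom c = {z. fst z \<noteq> snd z}"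
      using framed_image[OF c(2)] c(2) region_same by (simp add: framed_def)
    show "emeasure N U \<noteq> \<infinity>" if "U \<in> \<U>" for U
    proof -
      have U: "U \<in> chart_boxes c" using that \<U>(2) by blast
      then obtain a b where "chart_map c ` U = box a b" "cbox a b \<subseteq> {z. fst z \<noteq> snd z}"
        unfolding chart_boxes_def image by blast
      then show ?thesis
        using inverse_square_measure_box_finite by (simp add: eq[OF U])
    qed
  qed (use \<U> in auto)
qed

theorem proposition3p1:
  fixes l :: "(real ^ 2) set" and \<xi> :: "real ^ 2 \<Rightarrow> real"
  assumes "line_with_coordinate l \<xi>" and "0 \<notin> l"
  shows "\<exists>M. moebius_measure M \<and>
    (\<forall>N. is_form_measure {FCF1_chart l \<xi>} omega N \<longleftrightarrow>
         N = restrict_space M (chart_dom (FCF1_chart l \<xi>)))"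
proof (intro exI conjI allI iffI)
  obtain F where F: "frame_area F \<noteq> 0" "l = range (point F)" "\<And>t. \<xi> (point F t) = t"
    using line_with_coordinate_frame[OF assms] by blast
  note c = FCF1_chart_in_atlas[OF assms]
  have framed: "framed (FCF1_chart l \<xi>) F F"
    unfolding FCF1_chart_def by (rule product_chart_framed[OF F F])
  show "moebius_measure (chart_measure (FCF1_chart l \<xi>))"
    unfolding moebius_measure_def
    using moebius_form_invariant_form form_measure_invariant_form[OF assms] by blast
  show "N = restrict_space (chart_measure (FCF1_chart l \<xi>)) (chart_dom (FCF1_chart l \<xi>))"
    if "is_form_measure {FCF1_chart l \<xi>} omega N" for N
    using form_measure_omega_unique[OF c framed that] .
  show "is_form_measure {FCF1_chart l \<xi>} omega N"
    if "N = restrict_space (chart_measure (FCF1_chart l \<xi>)) (chart_dom (FCF1_chart l \<xi>))" for N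
    using form_measure_omega[OF c] that by simp
qed

end
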